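(* Let $q=(q_k)_{k\ge 0}$ be a probability distribution on $\{0,1,2,\dots\}$ with $q_0=0$ and $m:=\sum_{k\ge 0}k q_k\in(1,\infty)$, let $\nu$ be a random variable with distribution $q$, and let $\mathcal{T}$ be a Galton--Watson tree with offspring distribution $q$, whose law on the space of rooted trees is denoted $\mathrm{GW}$. Let $\mathbf{UNIF}$ be the uniform measure on the boundary $S(\mathcal{T})$ of $\mathcal{T}$. If $E[\nu\ln(\nu)]=\infty$, then $\dim(\mathbf{UNIF})=0$ for $\mathrm{GW}$-a.e. tree $\mathcal{T}$.
   Context: Trees and boundary. $e$ denotes the root of the tree, $|u|$ the height (generation) of a vertex $u$ (so $|e|=0$), and $Z_n$ the number of vertices at height $n$. For a vertex $u$, $Z_k(u)$ is the number of descendants $v$ of $u$ with $|v|=|u|+k$. The boundary $S(\mathcal{T})$ is the set of all infinite self-avoiding paths $r=(r_0=e,r_1,r_2,\dots)$ of $\mathcal{T}$ starting from the root (called rays; $|r_n|=n$), equipped with the metric $d(r,r'):=e^{-|r\wedge r'|}$, where $r\wedge r'$ is the highest vertex (the one of largest height) belonging to both $r$ and $r'$ (and $d(r,r)=0$). Normalizing constants. By the Seneta--Heyde theorem there are constants $(c_n)_{n\ge 0}$ such that, $\mathrm{GW}$-a.s., $\lim_{n\to\infty} Z_n/c_n$ exists, is finite and is strictly positive, and such that $\lim_{n\to\infty}c_{n+1}/c_n=m$. Fix such constants. For each vertex $u$ put $W_\infty(u):=\lim_{k\to\infty}Z_k(u)/c_k$ (almost surely this limit exists in $(0,\infty)$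 for all vertices $u$). One has $m^{-n}\sum_{|u|=n}W_\infty(u)=W_\infty(e)$ for all $n$. Uniform measure. $\mathbf{UNIF}$ is the unique Borel (probability) measure on $S(\mathcal{T})$ such that for every integer $n\ge 0$ and every vertex $u$ of height $n$, $$\mathbf{UNIF}(\{r\in S(\mathcal{T}):\, r_n=u\})=\frac{m^{-n}W_\infty(u)}{W_\infty(e)}.$$ Equivalently, this mass equals $\lim_{k\to\infty}Z_k(u)/Z_{n+k}$. Dimension of the measure. $\dim(\mathbf{UNIF}):=\min\{\dim(E):\ E\subset S(\mathcal{T}) \text{ measurable},\ \mathbf{UNIF}(E)=1\}$, where $\dim(E)$ is the Hausdorff dimension of $E$ with respect to the metric $d$. *)

theory Defs
  imports "HOL-Probability.Probability" "HOL-Library.Sublist"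
begin

section \<open>Rooted trees and the Galton--Watson law\<close>

text \<open>
  A vertex is a finite sequence of naturals (Ulam--Harris coding): the root is \<open>[]\<close>, the height
  of a vertex is its length, and the children of \<open>u\<close> are the vertices \<open>u @ [k]\<close>.
\<close>

type_synonym vertex = "nat list"
type_synonym tree = "vertex set"

definition rooted_tree :: "tree \<Rightarrow> bool" where
  "rooted_tree T \<longleftrightarrow> [] \<in> T \<and> (\<forall>u k. u @ [k] \<in> T \<longrightarrow> u \<in> T)
     \<and> (\<forall>u\<in>T. \<exists>n. {k. u @ [k] \<in> T} = {..<n})"

definition tree_space :: "tree measure" where
  "tree_space = sigma {T. rooted_tree T} {{T. rooted_tree T \<and> u \<in> T} | u. True}"

text \<open>\<open>\<omega> u\<close> is the number of children that \<open>u\<close> has if it belongs to the tree.\<close>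

definition gw_tree :: "(vertex \<Rightarrow> nat) \<Rightarrow> tree" where
  "gw_tree \<omega> = {u. \<forall>i<length u. u ! i < \<omega> (take i u)}"

definition GW :: "nat pmf \<Rightarrow> tree measure" where
  "GW q = distr (PiM UNIV (\<lambda>_. measure_pmf q)) tree_space gw_tree"

lemma rooted_tree_gw_tree: "rooted_tree (gw_tree \<omega>)"
proof -
  have snoc: "u @ [k] \<in> gw_tree \<omega> \<longleftrightarrow> u \<in> gw_tree \<omega> \<and> k < \<omega> u" for u k
    by (auto simp: gw_tree_def nth_append less_Suc_eq)
  have "[] \<in> gw_tree \<omega>" by (simp add: gw_tree_def)
  moreover have "\<exists>n. {k. u @ [k] \<in> gw_tree \<omega>} = {..<n}" if "u \<in> gw_tree \<omega>" for u
    using that by (intro exI[of _ "\<omega> u"]) (auto simp: snoc)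
  ultimately show ?thesis by (simp add: rooted_tree_def snoc)
qed

lemma measurable_gw_tree:
  "gw_tree \<in> measurable (PiM UNIV (\<lambda>_. measure_pmf q)) tree_space"
  unfolding tree_space_def
proof (rule measurable_measure_of)
  fix A assume "A \<in> {{T. rooted_tree T \<and> u \<in> T} | u. True}"
  then obtain u where A: "A = {T. rooted_tree T \<and> u \<in> T}" by auto
  have "{\<omega> \<in> space (PiM UNIV (\<lambda>_. measure_pmf q)). \<forall>i\<in>{..<length u}. u ! i < \<omega> (take i u)}
      \<in> sets (PiM UNIV (\<lambda>_. measure_pmf q))"
  proof (intro sets.sets_Collect_finite_All)
    fix i
    have "(\<lambda>\<omega>. \<omega> (take i u)) -` {u ! i<..} \<inter> space (PiM UNIV (\<lambda>_. measure_pmf q))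
        \<in> sets (PiM UNIV (\<lambda>_. measure_pmf q))"
      by (rule measurable_sets[OF measurable_component_singleton]) auto
    then show "{\<omega> \<in> space (PiM UNIV (\<lambda>_. measure_pmf q)). u ! i < \<omega> (take i u)}
        \<in> sets (PiM UNIV (\<lambda>_. measure_pmf q))"
      by (rule back_subst) auto
  qed simp
  also have "{\<omega> \<in> space (PiM UNIV (\<lambda>_. measure_pmf q)). \<forall>i\<in>{..<length u}. u ! i < \<omega> (take i u)}
      = gw_tree -` A \<inter> space (PiM UNIV (\<lambda>_. measure_pmf q))"
    using rooted_tree_gw_tree by (auto simp: A gw_tree_def)
  finally show "gw_tree -` A \<inter> space (PiM UNIV (\<lambda>_. measure_pmf q))
      \<in> sets (PiM UNIV (\<lambda>_. measure_pmf q))" .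
qed (auto simp: rooted_tree_gw_tree)

lemma prob_space_GW: "prob_space (GW q)"
proof -
  interpret P: product_prob_space "\<lambda>_. measure_pmf q" "UNIV :: vertex set"
    by unfold_locales
  show ?thesis
    unfolding GW_def by (intro P.prob_space_distr measurable_gw_tree)
qed

definition gen_size :: "tree \<Rightarrow> nat \<Rightarrow> vertex \<Rightarrow> nat" where
  "gen_size T k u = card {v \<in> T. prefix u v \<and> length v = length u + k}"


section \<open>The boundary of a tree\<close>

definition adjacent :: "vertex \<Rightarrow> vertex \<Rightarrow> bool" where
  "adjacent u v \<longleftrightarrow> (\<exists>k. v = u @ [k] \<or> u = v @ [k])"

type_synonym ray = "nat \<Rightarrow> vertex"

definition boundary :: "tree \<Rightarrow> ray set" where
  "boundary T = {r. r 0 = [] \<and> inj r \<and> (\<forall>n. r n \<in> T) \<and> (\<forall>n. adjacent (r n) (r (Suc n)))}"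

definition ray_meet :: "ray \<Rightarrow> ray \<Rightarrow> vertex" where
  "ray_meet r r' = (ARG_MAX length v. v \<in> range r \<inter> range r')"

definition ray_dist :: "ray \<Rightarrow> ray \<Rightarrow> real" where
  "ray_dist r r' = (if r = r' then 0 else exp (- real (length (ray_meet r r'))))"

lemma boundary_child:
  assumes "r \<in> boundary T"
  shows "length (r n) = n \<and> (\<exists>k. r (Suc n) = r n @ [k])"
proof (induction n)
  case 0
  then show ?case
    using assms by (auto simp: boundary_def adjacent_def dest: spec[of _ 0])
next
  case (Suc n)
  then obtain k where k: "r (Suc n) = r n @ [k]" and l: "length (r n) = n" by auto
  have adj: "adjacent (r (Suc n)) (r (Suc (Suc n)))" and inj: "inj r"
    using assms by (auto simp: boundary_def)
  have "r (Suc (Suc n)) \<noteq> r n"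
    using inj by (metis Suc_n_not_le_n injD le_SucI order_refl)
  then show ?case
    using adj k l by (auto simp: adjacent_def)
qed

lemma boundary_length: "r \<in> boundary T \<Longrightarrow> length (r n) = n"
  using boundary_child by blast

lemma boundary_take:
  assumes "r \<in> boundary T" "k \<le> n"
  shows "r k = take k (r n)"
  using assms(2)
proof (induction n rule: dec_induct)
  case base
  then show ?case using boundary_length[OF assms(1)] by simp
next
  case (step n)
  then show ?case
    using boundary_child[OF assms(1), of n] by auto
qed

lemma length_ray_meet:
  assumes r: "r \<in> boundary T" and r': "r' \<in> boundary T" and "r \<noteq> r'"
  shows "r n = r' n \<longleftrightarrow> n \<le> length (ray_meet r r')"
proof -
  let ?P = "\<lambda>v. v \<in> range r \<inter> range r'"
  obtain N where N: "r N \<noteq> r' N" using \<open>r \<noteq> r'\<close> by auto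
  have P: "v = r (length v) \<and> v = r' (length v)" if "?P v" for v
    using that boundary_length[OF r] boundary_length[OF r'] by (metis IntD1 IntD2 rangeE)
  have bound: "length v < N" if "?P v" for v
  proof (rule ccontr)
    assume "\<not> length v < N"
    then have "r N = r' N"
      using P[OF that] boundary_take[OF r, of N "length v"] boundary_take[OF r', of N "length v"]
      by simp
    with N show False by simp
  qed
  have "r 0 = []" "r' 0 = []" using r r' by (auto simp: boundary_def)
  then have root: "?P []" by (metis IntI rangeI)
  have max: "?P (ray_meet r r') \<and> (\<forall>v. ?P v \<longrightarrow> length v \<le> length (ray_meet r r'))"
    unfolding ray_meet_def using root bound by (intro arg_max_nat_lemma[where b = N]) auto
  show ?thesis
  proof
    assume "r n = r' n"
    then have "?P (r n)" by (metis IntI rangeI)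
    then show "n \<le> length (ray_meet r r')" using max boundary_length[OF r] by metis
  next
    assume "n \<le> length (ray_meet r r')"
    then show "r n = r' n"
      using P[of "ray_meet r r'"] max boundary_take[OF r] boundary_take[OF r'] by metis
  qed
qed

lemma ray_meet_commute: "ray_meet r r' = ray_meet r' r"
  by (simp add: ray_meet_def conj_commute)

lemma Metric_space_boundary: "Metric_space (boundary T) ray_dist"
proof
  fix x y z assume x: "x \<in> boundary T" and y: "y \<in> boundary T" and z: "z \<in> boundary T"
  show "ray_dist x z \<le> ray_dist x y + ray_dist y z"
  proof (cases "x = y \<or> y = z \<or> x = z")
    case True
    then show ?thesis by (auto simp: ray_dist_def)
  next
    case False
    let ?n = "min (length (ray_meet x y)) (length (ray_meet y z))"
    have "x ?n = y ?n" "y ?n = z ?n"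
      using False length_ray_meet[OF x y, of ?n] length_ray_meet[OF y z, of ?n] by simp_all
    then have "?n \<le> length (ray_meet x z)"
      using False length_ray_meet[OF x z, of ?n] by simp
    then have "length (ray_meet x y) \<le> length (ray_meet x z)
        \<or> length (ray_meet y z) \<le> length (ray_meet x z)" by linarith
    then have "exp (- real (length (ray_meet x z))) \<le> exp (- real (length (ray_meet x y)))
        \<or> exp (- real (length (ray_meet x z))) \<le> exp (- real (length (ray_meet y z)))"
      by simp
    then have "exp (- real (length (ray_meet x z)))
        \<le> exp (- real (length (ray_meet x y))) + exp (- real (length (ray_meet y z)))"
      by (meson add_increasing add_increasing2 exp_ge_zero)
    then show ?thesis using False by (simp only: ray_dist_def) simp
  qed
qed (auto simp: ray_dist_def ray_meet_commute)

definition boundary_borel :: "tree \<Rightarrow> ray measure" where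
  "boundary_borel T =
     sigma (boundary T) {U. openin (Metric_space.mtopology (boundary T) ray_dist) U}"

lemma sets_cylinder: "{r \<in> boundary T. r n = u} \<in> sets (boundary_borel T)"
proof -
  interpret Metric_space "boundary T" ray_dist by (rule Metric_space_boundary)
  have "openin mtopology {r \<in> boundary T. r n = u}"
    unfolding openin_mtopology
  proof (intro conjI allI impI)
    fix x assume "x \<in> {r \<in> boundary T. r n = u}"
    then have x: "x \<in> boundary T" "x n = u" by auto
    have "y n = u" if y: "y \<in> boundary T" and d: "ray_dist x y < exp (- real n)" for y
    proof (cases "x = y")
      case False
      then have "n \<le> length (ray_meet x y)" using d by (simp add: ray_dist_def)
      then show ?thesis using length_ray_meet[OF x(1) y False] x by metis
    qed (use x in auto)
    then have "mball x (exp (- real n)) \<subseteq> {r \<in> boundary T. r n = u}"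
      by (auto simp: in_mball)
    then show "\<exists>e>0. mball x e \<subseteq> {r \<in> boundary T. r n = u}"
      by (intro exI[of _ "exp (- real n)"]) auto
  qed auto
  moreover have "{U. openin mtopology U} \<subseteq> Pow (boundary T)"
    using openin_subset[of mtopology] by auto
  ultimately show ?thesis
    by (simp add: boundary_borel_def)
qed


section \<open>The uniform measure\<close>

definition W_inf :: "(nat \<Rightarrow> real) \<Rightarrow> tree \<Rightarrow> vertex \<Rightarrow> real" where
  "W_inf c T u = lim (\<lambda>k. real (gen_size T k u) / c k)"

definition is_uniform_measure :: "real \<Rightarrow> (nat \<Rightarrow> real) \<Rightarrow> tree \<Rightarrow> ray measure \<Rightarrow> bool" where
  "is_uniform_measure m c T \<mu> \<longleftrightarrow>
     sets \<mu> = sets (boundary_borel T) \<and> prob_space \<mu> \<and>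
     (\<forall>n. \<forall>u\<in>T. length u = n \<longrightarrow>
        emeasure \<mu> {r \<in> boundary T. r n = u} = ennreal (m powi (- int n) * W_inf c T u / W_inf c T []))"

definition UNIF :: "real \<Rightarrow> (nat \<Rightarrow> real) \<Rightarrow> tree \<Rightarrow> ray measure" where
  "UNIF m c T = (THE \<mu>. is_uniform_measure m c T \<mu>)"


section \<open>Hausdorff dimension\<close>

definition ediam :: "('a \<Rightarrow> 'a \<Rightarrow> real) \<Rightarrow> 'a set \<Rightarrow> ennreal" where
  "ediam d U = (SUP x\<in>U. SUP y\<in>U. ennreal (d x y))"

text \<open>
  The conventions are \<open>diam {} ^ s = 0\<close> for all \<open>s \<ge> 0\<close> and \<open>diam U ^ 0 = 1\<close> for nonempty \<open>U\<close>.
  Since \<open>0 powr 0 = 0\<close>, the second one has to be built in by hand. The function is only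
  applied to sets of finite diameter, so that \<^const>\<open>enn2real\<close> does not truncate.
\<close>

definition hausdorff_gauge :: "('a \<Rightarrow> 'a \<Rightarrow> real) \<Rightarrow> real \<Rightarrow> 'a set \<Rightarrow> ennreal" where
  "hausdorff_gauge d s U =
     (if U = {} then 0 else if s = 0 then 1 else ennreal (enn2real (ediam d U) powr s))"

definition hausdorff_content :: "'a set \<Rightarrow> ('a \<Rightarrow> 'a \<Rightarrow> real) \<Rightarrow> real \<Rightarrow> real \<Rightarrow> 'a set \<Rightarrow> ennreal" where
  "hausdorff_content S d s \<delta> E =
     Inf {(\<Sum>i. hausdorff_gauge d s (U i)) | U :: nat \<Rightarrow> 'a set.
            (\<forall>i. U i \<subseteq> S \<and> ediam d (U i) \<le> ennreal \<delta>) \<and> E \<subseteq> (\<Union>i. U i)}"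

definition hausdorff_measure :: "'a set \<Rightarrow> ('a \<Rightarrow> 'a \<Rightarrow> real) \<Rightarrow> real \<Rightarrow> 'a set \<Rightarrow> ennreal" where
  "hausdorff_measure S d s E = (SUP \<delta>\<in>{0<..}. hausdorff_content S d s \<delta> E)"

definition hausdorff_dim :: "'a set \<Rightarrow> ('a \<Rightarrow> 'a \<Rightarrow> real) \<Rightarrow> 'a set \<Rightarrow> ennreal" where
  "hausdorff_dim S d E = Inf {ennreal s | s. s \<ge> 0 \<and> hausdorff_measure S d s E = 0}"

text \<open>
  The minimum over the sets of full measure is rendered by \<^const>\<open>Least\<close>, so a value \<open>x\<close> is
  established only by exhibiting a set of full measure whose dimension is exactly \<open>x\<close>.
\<close>

definition measure_dim :: "('a \<Rightarrow> 'a \<Rightarrow> real) \<Rightarrow> 'a measure \<Rightarrow> ennreal" where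
  "measure_dim d \<mu> =
     (LEAST x. \<exists>E\<in>sets \<mu>. emeasure \<mu> E = 1 \<and> x = hausdorff_dim (space \<mu>) d E)"

end

theory Submission
  imports Defs
begin

text \<open>
  Let \<open>W\<close> be the normalised limit of the tree and \<open>L x = E [W; W < x]\<close>, a slowly growing function.
  Along a size-biased line of descent \<open>m ^ d * W\<close> is the sum of the limit of the descendant at level
  \<open>d\<close> and the independent mass \<open>R\<close> of its cousins, whence \<open>P (R < y) * L y \<le> L (2 * y / m ^ d)\<close>.
  Decomposing at the first level, \<open>E (\<nu> ln \<nu>) = \<infinity>\<close> forces \<open>L x \<longrightarrow> \<infinity>\<close>.
  Call a vertex \<open>u\<close> at level \<open>n\<close> heavy if \<open>W u \<ge> m ^ ((1 - \<epsilon>) n)\<close>. Chaining the inequality over levels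
  \<open>n\<^sub>0 < n\<^sub>1 < \<dots>\<close> that at least double, the expected mass of the rays avoiding the heavy vertices of
  all these levels is at most \<open>\<Prod>i. L (x\<^sub>i) / L (x\<^sub>i powr (1 + \<epsilon>'))\<close> with \<open>x\<^sub>i = m ^ ((1 - \<epsilon>) n\<^sub>i)\<close>
  up to constants. As \<open>L\<close> is unbounded, the levels can be chosen so that this product vanishes.
  So almost every ray meets heavy vertices infinitely often, for every \<open>\<epsilon>\<close>. There are
  at most about \<open>m ^ (\<epsilon> n)\<close> heavy vertices at level \<open>n\<close>, so the set of these rays has dimension \<open>0\<close>.
\<close>

section \<open>Levels and subtrees\<close>

text \<open>\<open>W\<close> turns out to have infinite mean, so weighting the tree by
  \<open>W\<close> gives no probability law. Size-biased statements are therefore sums over a level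
  under the plain law \<open>GW q\<close>, and means are truncated; \<open>L x \<le> x\<close> keeps
  the quotients finite.

  The decomposition \<open>m ^ d * W = W v + R\<close> is used in both directions. If both summands
  are below \<open>y\<close>, then \<open>W < 2 * y / m ^ d\<close>: this bounds the law of
  \<open>R\<close>. If \<open>W < x\<close>, then \<open>R < m ^ d * x\<close>: this turns a
  truncation at the root into an event independent of the subtree at \<open>v\<close>, which is what
  permits chaining.

  All that is known of \<open>L\<close> is that it is unbounded, without any rate. Its quotients
  telescope along levels whose ratio is close to 1, whereas chaining needs levels that at least
  double. A sequence with small steps is therefore split into finitely many doubling ones.\<close>

definition desc :: "tree \<Rightarrow> vertex \<Rightarrow> nat \<Rightarrow> vertex set" where
  "desc T u k = {v \<in> T. prefix u v \<and> length v = length u + k}"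

abbreviation level :: "tree \<Rightarrow> nat \<Rightarrow> vertex set" where
  "level T \<equiv> desc T []"

lemma mem_level: "v \<in> level T d \<longleftrightarrow> v \<in> T \<and> length v = d"
  by (auto simp: desc_def)

lemma gen_size_eq_card: "gen_size T k u = card (desc T u k)"
  by (simp add: gen_size_def desc_def)

lemma rooted_tree_append:
  assumes "rooted_tree T" "u @ v \<in> T"
  shows "u \<in> T"
  using assms(2)
proof (induction v rule: rev_induct)
  case (snoc x v)
  then show ?case using assms(1) by (metis append.assoc rooted_tree_def)
qed simp

lemma rooted_tree_prefix: "rooted_tree T \<Longrightarrow> v \<in> T \<Longrightarrow> prefix u v \<Longrightarrow> u \<in> T"
  by (auto simp: prefix_def rooted_tree_append)

lemma desc_1: "desc T u 1 = (\<lambda>k. u @ [k]) ` {k. u @ [k] \<in> T}"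
proof (intro equalityI subsetI)
  fix v assume "v \<in> desc T u 1"
  then obtain w where "v = u @ w" "length w = 1" "v \<in> T" by (auto simp: desc_def prefix_def)
  then show "v \<in> (\<lambda>k. u @ [k]) ` {k. u @ [k] \<in> T}" by (auto simp: length_Suc_conv)
qed (auto simp: desc_def)

lemma finite_children: "rooted_tree T \<Longrightarrow> finite {k. u @ [k] \<in> T}"
proof -
  assume T: "rooted_tree T"
  show ?thesis
  proof (cases "u \<in> T")
    case True
    then obtain n where "{k. u @ [k] \<in> T} = {..<n}" using T by (auto simp: rooted_tree_def)
    then show ?thesis by simp
  next
    case False
    then have "{k. u @ [k] \<in> T} = {}" using T by (auto simp: rooted_tree_def)
    then show ?thesis by (simp only:) simp
  qed
qed

lemma desc_add:
  assumes "rooted_tree T"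
  shows "desc T u (j + k) = (\<Union>v\<in>desc T u j. desc T v k)"
proof (intro equalityI subsetI)
  fix x assume x: "x \<in> desc T u (j + k)"
  then obtain w where w: "x = u @ w" "length w = j + k" "x \<in> T" by (auto simp: desc_def prefix_def)
  let ?v = "u @ take j w"
  have x: "x = ?v @ drop j w" using w(1) by simp
  then have "?v \<in> T" using rooted_tree_append[OF assms] w(3) by metis
  moreover have "prefix ?v x" using x prefixI by blast
  ultimately have "?v \<in> desc T u j" "x \<in> desc T ?v k" using w
    by (simp_all add: desc_def)
  then show "x \<in> (\<Union>v\<in>desc T u j. desc T v k)" by blast
qed (auto simp: desc_def intro: prefix_order.trans)

lemma finite_desc:
  assumes "rooted_tree T"
  shows "finite (desc T u k)"
proof (induction k)
  case 0
  show ?case by (rule finite_subset[of _ "{u}"]) (auto simp: desc_def prefix_def)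
next
  case (Suc k)
  have "finite (desc T v 1)" for v
    unfolding desc_1 using finite_children[OF assms] by (rule finite_imageI)
  then show ?case
    using desc_add[OF assms, of u k 1] Suc by simp
qed

lemma disjoint_desc:
  assumes "v \<in> desc T u j" "v' \<in> desc T u j" "v \<noteq> v'"
  shows "desc T v k \<inter> desc T v' k = {}"
  using assms by (auto simp: desc_def prefix_def)

lemma sum_desc_add:
  assumes "rooted_tree T"
  shows "(\<Sum>v\<in>desc T u (j + k). f v) = (\<Sum>v\<in>desc T u j. \<Sum>x\<in>desc T v k. f x)"
  unfolding desc_add[OF assms]
  by (rule sum.UNION_disjoint) (auto simp: finite_desc[OF assms] disjoint_desc)

lemma gen_size_add:
  assumes "rooted_tree T"
  shows "gen_size T (j + k) u = (\<Sum>v\<in>desc T u j. gen_size T k v)"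
  using sum_desc_add[OF assms, of "\<lambda>_. 1 :: nat" u j k] by (simp add: gen_size_eq_card)

text \<open>The default value makes \<open>subtree\<close> a map from rooted trees to rooted trees.\<close>

definition subtree :: "tree \<Rightarrow> vertex \<Rightarrow> tree" where
  "subtree T v = (if v \<in> T then {u. v @ u \<in> T} else {[]})"

lemma rooted_tree_subtree:
  assumes "rooted_tree T"
  shows "rooted_tree (subtree T v)"
proof (cases "v \<in> T")
  case True
  have "\<exists>n. {k. (v @ u) @ [k] \<in> T} = {..<n}" if "v @ u \<in> T" for u
    using assms that unfolding rooted_tree_def by blast
  then show ?thesis
    using True assms unfolding subtree_def rooted_tree_def
    by (auto simp flip: append_assoc)
qed (auto simp: subtree_def rooted_tree_def)

lemma subtree_subtree: "v \<in> T \<Longrightarrow> x \<in> subtree T v \<Longrightarrow> subtree (subtree T v) x = subtree T (v @ x)"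
  by (auto simp: subtree_def)

lemma desc_subtree: "v \<in> T \<Longrightarrow> desc T (v @ u) k = (@) v ` desc (subtree T v) u k"
  by (auto simp: desc_def subtree_def prefix_def image_iff)

lemma desc_eq_level: "v \<in> T \<Longrightarrow> desc T v k = (@) v ` level (subtree T v) k"
  using desc_subtree[of v T "[]" k] by simp

lemma gen_size_subtree: "v \<in> T \<Longrightarrow> gen_size T k (v @ u) = gen_size (subtree T v) k u"
  by (simp add: gen_size_eq_card desc_subtree card_image inj_on_def)

lemma W_inf_subtree: "v \<in> T \<Longrightarrow> W_inf c (subtree T v) u = W_inf c T (v @ u)"
  by (simp add: W_inf_def gen_size_subtree)

lemma sum_desc_subtree:
  "v \<in> T \<Longrightarrow> (\<Sum>x\<in>desc T v d. f x) = (\<Sum>x\<in>level (subtree T v) d. f (v @ x))"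
  by (simp add: desc_eq_level sum.reindex inj_on_def)

section \<open>Measurability on the space of trees\<close>

lemma space_tree_space: "space tree_space = {T. rooted_tree T}"
  unfolding tree_space_def by (rule space_measure_of) auto

lemma sets_mem_tree [measurable]: "Measurable.pred tree_space (\<lambda>T. u \<in> T)"
proof -
  have "{T. rooted_tree T \<and> u \<in> T} \<in> sets tree_space"
    unfolding tree_space_def by (rule in_measure_of) auto
  then show ?thesis
    by (simp add: pred_def space_tree_space)
qed

lemma measurable_into_tree_space:
  assumes "\<And>x. x \<in> space M \<Longrightarrow> rooted_tree (f x)"
    and "\<And>u. Measurable.pred M (\<lambda>x. u \<in> f x)"
  shows "f \<in> measurable M tree_space"
  unfolding tree_space_def
proof (rule measurable_measure_of)
  fix A assume "A \<in> {{T. rooted_tree T \<and> u \<in> T} | u. True}"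
  then obtain u where A: "A = {T. rooted_tree T \<and> u \<in> T}" by auto
  have "f -` A \<inter> space M = {x \<in> space M. u \<in> f x}" using assms(1) by (auto simp: A)
  then show "f -` A \<inter> space M \<in> sets M" using assms(2)[of u] by (simp add: pred_def)
qed (use assms(1) in auto)

lemma measurable_subtree [measurable]: "(\<lambda>T. subtree T v) \<in> measurable tree_space tree_space"
proof (rule measurable_into_tree_space)
  fix u
  have "u \<in> subtree T v \<longleftrightarrow> (v \<in> T \<and> v @ u \<in> T) \<or> (v \<notin> T \<and> u = [])" for T
    by (auto simp: subtree_def)
  then show "Measurable.pred tree_space (\<lambda>T. u \<in> subtree T v)" by simp
qed (auto simp: space_tree_space rooted_tree_subtree)

text \<open>The range of summation depends on \<open>T\<close>. As an integral over all vertices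
  with an indicator it becomes a countable sum whose terms are measurable in
  \<open>T\<close>.\<close>

lemma sum_desc_eq_nn_integral:
  fixes h :: "vertex \<Rightarrow> ennreal"
  assumes "rooted_tree T"
  shows "(\<Sum>v\<in>desc T u d. h v) = (\<integral>\<^sup>+ v. h v * indicator (desc T u d) v \<partial>count_space UNIV)"
  by (subst nn_integral_count_space'[of "desc T u d"]) (auto simp: finite_desc[OF assms])

lemma indicator_desc: "indicator (desc T u d) v
    = (if v \<in> T \<and> prefix u v \<and> length v = length u + d then 1 else 0)"
  by (auto simp: desc_def indicator_def)

lemma measurable_sum_desc [measurable]:
  fixes h :: "tree \<Rightarrow> vertex \<Rightarrow> ennreal"
  assumes [measurable]: "\<And>v. (\<lambda>T. h T v) \<in> borel_measurable tree_space"
  shows "(\<lambda>T. \<Sum>v\<in>desc T u d. h T v) \<in> borel_measurable tree_space"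
proof -
  have "(\<lambda>T. \<integral>\<^sup>+ v. h T v * indicator (desc T u d) v \<partial>count_space UNIV) \<in> borel_measurable tree_space"
    unfolding indicator_desc
    by (subst nn_integral_bij_count_space[symmetric, OF bij_betw_from_nat_into])
      (auto simp: nn_integral_count_space_nat infinite_UNIV_listI)
  then show ?thesis
    by (subst measurable_cong[where g="\<lambda>T. \<integral>\<^sup>+ v. h T v * indicator (desc T u d) v \<partial>count_space UNIV"])
      (auto simp: space_tree_space sum_desc_eq_nn_integral)
qed

lemma measurable_gen_size [measurable]:
  "(\<lambda>T. real (gen_size T k u)) \<in> borel_measurable tree_space"
proof -
  have "(\<lambda>T. enn2real (\<Sum>v\<in>desc T u k. 1)) \<in> borel_measurable tree_space"
    by measurable
  then show ?thesis by (simp add: gen_size_eq_card flip: ennreal_of_nat_eq_real_of_nat)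
qed

lemma measurable_W_inf [measurable]: "(\<lambda>T. W_inf c T u) \<in> borel_measurable tree_space"
  unfolding W_inf_def by measurable

text \<open>Exchanging sum and integral passes from a random level to fixed vertices, the form in
  which \<open>branching\<close> applies.\<close>

lemma nn_integral_sum_level:
  fixes h :: "tree \<Rightarrow> vertex \<Rightarrow> ennreal"
  assumes [measurable]: "\<And>v. (\<lambda>T. h T v) \<in> borel_measurable tree_space"
    and M: "sets M = sets tree_space"
  shows "(\<integral>\<^sup>+ T. (\<Sum>v\<in>level T d. h T v) \<partial>M)
    = (\<integral>\<^sup>+ v. (\<integral>\<^sup>+ T. h T v * indicator {T. v \<in> T} T \<partial>M) \<partial>count_space {v. length v = d})"
proof -
  have [measurable]: "(\<lambda>T. h T v) \<in> borel_measurable M" "Measurable.pred M (\<lambda>T. v \<in> T)" for v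
    using measurable_cong_sets[OF M refl] assms(1) sets_mem_tree by blast+
  have sp: "space M = {T. rooted_tree T}"
    using sets_eq_imp_space_eq[OF M] by (simp add: space_tree_space)
  have ind: "h T v * indicator (desc T [] d) v
      = h T v * indicator {T. v \<in> T} T * indicator {v. length v = d} v" for T v
    by (auto simp: mem_level split: split_indicator)
  have "(\<integral>\<^sup>+ T. (\<Sum>v\<in>level T d. h T v) \<partial>M)
      = (\<integral>\<^sup>+ T. (\<integral>\<^sup>+ v. h T v * indicator {T. v \<in> T} T \<partial>count_space {v. length v = d}) \<partial>M)"
    by (intro nn_integral_cong)
      (simp add: sp sum_desc_eq_nn_integral ind flip: nn_integral_count_space_indicator)
  also have "\<dots> = (\<integral>\<^sup>+ v. (\<integral>\<^sup>+ T. h T v * indicator {T. v \<in> T} T \<partial>M) \<partial>count_space {v. length v = d})"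
    by (rule nn_integral_count_space_nn_integral) auto
  finally show ?thesis .
qed

section \<open>The branching property\<close>

text \<open>Resampling device: two independent offspring families are spliced at \<open>v\<close>
  into one with the same law, so that independence of the subtree and the pruned tree becomes a
  product measure.\<close>

definition graft :: "vertex \<Rightarrow> (vertex \<Rightarrow> nat) \<times> (vertex \<Rightarrow> nat) \<Rightarrow> vertex \<Rightarrow> nat" where
  "graft v = (\<lambda>(\<omega>, \<omega>') u. if prefix v u then \<omega> (drop (length v) u) else \<omega>' u)"

abbreviation offspring :: "nat pmf \<Rightarrow> (vertex \<Rightarrow> nat) measure" where
  "offspring q \<equiv> PiM UNIV (\<lambda>_. measure_pmf q)"

lemma measurable_graft [measurable]:
  "graft v \<in> measurable (offspring q \<Otimes>\<^sub>M offspring q) (offspring q)"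
proof (rule measurable_PiM_single')
  fix u
  show "(\<lambda>x. graft v x u) \<in> measurable (offspring q \<Otimes>\<^sub>M offspring q) (measure_pmf q)"
    by (cases "prefix v u") (simp_all add: graft_def case_prod_beta)
qed (auto simp: space_PiM)

lemma distr_graft: "distr (offspring q \<Otimes>\<^sub>M offspring q) (offspring q) (graft v) = offspring q"
proof -
  interpret P: product_prob_space "\<lambda>_. measure_pmf q" "UNIV :: vertex set" by unfold_locales
  interpret PP: pair_prob_space "offspring q" "offspring q" ..
  show ?thesis
  proof (rule P.PiM_eq)
    fix J :: "vertex set" and F :: "vertex \<Rightarrow> nat set" assume J: "finite J"
    \<comment> \<open>Coordinates of \<open>J\<close> below \<open>v\<close> are read from the first
      family after stripping the prefix, the others from the second; the event is thus a
      rectangle.\<close>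
    let ?J1 = "{u. v @ u \<in> J}" and ?J2 = "{u\<in>J. \<not> prefix v u}"
    have J_eq: "J = (@) v ` ?J1 \<union> ?J2" "(@) v ` ?J1 \<inter> ?J2 = {}" by (auto simp: prefix_def)
    have fin: "finite ?J1"
      by (rule finite_subset[OF _ finite_imageI[OF J, of "drop (length v)"]]) force
    have fin2: "finite ?J2" using J by simp
    have emb: "prod_emb UNIV (\<lambda>_. measure_pmf q) K (Pi\<^sub>E K G) = {\<omega>. \<forall>u\<in>K. \<omega> u \<in> G u}" for K G
      by (auto simp: prod_emb_def space_PiM)
    have meas: "{\<omega>. \<forall>u\<in>K. \<omega> u \<in> G u} \<in> sets (offspring q)"
      "emeasure (offspring q) {\<omega>. \<forall>u\<in>K. \<omega> u \<in> G u} = (\<Prod>u\<in>K. emeasure (measure_pmf q) (G u))"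
      if "finite K" for K G
      using P.emeasure_PiM_emb[of K G] sets_PiM_I[of K UNIV G "\<lambda>_. measure_pmf q"] that by (auto simp: emb)
    have "graft v -` {\<omega>. \<forall>u\<in>J. \<omega> u \<in> F u} \<inter> space (offspring q \<Otimes>\<^sub>M offspring q)
        = {\<omega>. \<forall>u\<in>?J1. \<omega> u \<in> F (v @ u)} \<times> {\<omega>. \<forall>u\<in>?J2. \<omega> u \<in> F u}"
      by (subst (1) J_eq(1)) (auto simp: graft_def space_pair_measure space_PiM ball_Un split: if_splits)
    then have "emeasure (distr (offspring q \<Otimes>\<^sub>M offspring q) (offspring q) (graft v)) {\<omega>. \<forall>u\<in>J. \<omega> u \<in> F u}
        = emeasure (offspring q \<Otimes>\<^sub>M offspring q)
            ({\<omega>. \<forall>u\<in>?J1. \<omega> u \<in> F (v @ u)} \<times> {\<omega>. \<forall>u\<in>?J2. \<omega> u \<in> F u})"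
      using meas(1)[OF J] by (subst emeasure_distr) auto
    also have "\<dots> = (\<Prod>u\<in>?J1. emeasure (measure_pmf q) (F (v @ u))) * (\<Prod>u\<in>?J2. emeasure (measure_pmf q) (F u))"
      using fin fin2 by (subst P.emeasure_pair_measure_Times) (simp_all only: meas)
    also have "(\<Prod>u\<in>?J1. emeasure (measure_pmf q) (F (v @ u)))
        = (\<Prod>u\<in>(@) v ` ?J1. emeasure (measure_pmf q) (F u))"
      by (simp add: prod.reindex inj_on_def)
    also have "\<dots> * (\<Prod>u\<in>?J2. emeasure (measure_pmf q) (F u)) = (\<Prod>u\<in>J. emeasure (measure_pmf q) (F u))"
      using J fin J_eq by (subst prod.union_disjoint[symmetric]) auto
    finally show "emeasure (distr (offspring q \<Otimes>\<^sub>M offspring q) (offspring q) (graft v))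
          (prod_emb UNIV (\<lambda>_. measure_pmf q) J (Pi\<^sub>E J F))
        = (\<Prod>u\<in>J. emeasure (measure_pmf q) (F u))"
      by (simp add: emb)
  qed simp
qed

text \<open>Membership of \<open>u\<close> is decided by the offspring numbers at its strict
  prefixes, so splicing at \<open>v\<close> is invisible at \<open>v\<close> itself and everywhere
  not strictly below it.\<close>

lemma gw_tree_graft_off:
  assumes "\<not> strict_prefix v u"
  shows "u \<in> gw_tree (graft v (\<omega>, \<omega>')) \<longleftrightarrow> u \<in> gw_tree \<omega>'"
proof -
  have "\<not> prefix v (take i u)" if "i < length u" for i
  proof
    assume "prefix v (take i u)"
    moreover have "strict_prefix (take i u) u"
      using that by (auto simp: strict_prefix_def take_is_prefix dest: arg_cong[of _ _ length])
    ultimately show False using assms prefix_order.le_less_trans by blast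
  qed
  then show ?thesis by (auto simp: gw_tree_def graft_def)
qed

lemma subtree_gw_tree_graft:
  assumes "v \<in> gw_tree \<omega>'"
  shows "subtree (gw_tree (graft v (\<omega>, \<omega>'))) v = gw_tree \<omega>"
proof -
  let ?T = "gw_tree (graft v (\<omega>, \<omega>'))"
  have v: "v \<in> ?T" using assms gw_tree_graft_off[of v v] by simp
  have "v @ u \<in> ?T \<longleftrightarrow> u \<in> gw_tree \<omega>" for u
  proof
    assume A: "v @ u \<in> ?T"
    show "u \<in> gw_tree \<omega>"
      unfolding gw_tree_def
    proof clarify
      fix i assume "i < length u"
      then show "u ! i < \<omega> (take i u)"
        using A[unfolded gw_tree_def, simplified, rule_format, of "length v + i"]
        by (simp add: graft_def)
    qed
  next
    assume A: "u \<in> gw_tree \<omega>"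
    show "v @ u \<in> ?T"
      unfolding gw_tree_def
    proof clarify
      fix i assume i: "i < length (v @ u)"
      show "(v @ u) ! i < graft v (\<omega>, \<omega>') (take i (v @ u))"
      proof (cases "i < length v")
        case True
        then show ?thesis using v by (auto simp: gw_tree_def nth_append)
      next
        case False
        then show ?thesis using A i by (auto simp: gw_tree_def nth_append graft_def)
      qed
    qed
  qed
  then show ?thesis using v by (simp add: subtree_def)
qed

lemma sets_GW [measurable_cong]: "sets (GW q) = sets tree_space"
  by (simp add: GW_def)

lemma space_GW: "space (GW q) = {T. rooted_tree T}"
  by (simp add: GW_def space_tree_space)

text \<open>The hypothesis \<open>local\<close> says that \<open>G\<close> only depends on the tree pruned at \<open>v\<close>.\<close>

lemma branching:
  fixes F G :: "tree \<Rightarrow> ennreal"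
  assumes F [measurable]: "F \<in> borel_measurable tree_space"
    and G [measurable]: "G \<in> borel_measurable tree_space"
    and local: "\<And>T T'. rooted_tree T \<Longrightarrow> rooted_tree T' \<Longrightarrow>
       (\<And>u. \<not> strict_prefix v u \<Longrightarrow> u \<in> T \<longleftrightarrow> u \<in> T') \<Longrightarrow> v \<in> T \<Longrightarrow> G T = G T'"
  shows "(\<integral>\<^sup>+ T. F (subtree T v) * G T * indicator {T. v \<in> T} T \<partial>GW q)
    = (\<integral>\<^sup>+ T. F T \<partial>GW q) * (\<integral>\<^sup>+ T. G T * indicator {T. v \<in> T} T \<partial>GW q)"
proof -
  interpret P: product_prob_space "\<lambda>_. measure_pmf q" "UNIV :: vertex set" by unfold_locales
  interpret PP: pair_prob_space "offspring q" "offspring q" ..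
  note [measurable] = measurable_gw_tree
  have pt: "F (subtree (gw_tree (graft v (\<omega>, \<omega>'))) v) * G (gw_tree (graft v (\<omega>, \<omega>')))
        * indicator {T. v \<in> T} (gw_tree (graft v (\<omega>, \<omega>')))
      = F (gw_tree \<omega>) * (G (gw_tree \<omega>') * indicator {T. v \<in> T} (gw_tree \<omega>'))" for \<omega> \<omega>'
  proof (cases "v \<in> gw_tree \<omega>'")
    case True
    moreover have "v \<in> gw_tree (graft v (\<omega>, \<omega>'))"
      using True gw_tree_graft_off[of v v] by simp
    moreover have "G (gw_tree (graft v (\<omega>, \<omega>'))) = G (gw_tree \<omega>')"
      using \<open>v \<in> gw_tree (graft v (\<omega>, \<omega>'))\<close>
      by (intro local) (auto simp: rooted_tree_gw_tree gw_tree_graft_off)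
    ultimately show ?thesis by (simp add: subtree_gw_tree_graft mult.assoc)
  next
    case False
    then show ?thesis using gw_tree_graft_off[of v v] by simp
  qed
  have "(\<integral>\<^sup>+ T. F (subtree T v) * G T * indicator {T. v \<in> T} T \<partial>GW q)
      = (\<integral>\<^sup>+ \<omega>. F (subtree (gw_tree \<omega>) v) * G (gw_tree \<omega>) * indicator {T. v \<in> T} (gw_tree \<omega>) \<partial>offspring q)"
    unfolding GW_def by (rule nn_integral_distr) measurable
  \<comment> \<open>Splicing leaves the law of the family unchanged and makes the integrand a
    product over the two factors.\<close>
  also have "\<dots> = (\<integral>\<^sup>+ \<omega>. F (subtree (gw_tree \<omega>) v) * G (gw_tree \<omega>) * indicator {T. v \<in> T} (gw_tree \<omega>)
      \<partial>distr (offspring q \<Otimes>\<^sub>M offspring q) (offspring q) (graft v))"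
    by (simp add: distr_graft)
  also have "\<dots> = (\<integral>\<^sup>+ x. F (subtree (gw_tree (graft v x)) v) * G (gw_tree (graft v x))
      * indicator {T. v \<in> T} (gw_tree (graft v x)) \<partial>(offspring q \<Otimes>\<^sub>M offspring q))"
    by (rule nn_integral_distr) measurable
  also have "\<dots> = (\<integral>\<^sup>+ \<omega>. \<integral>\<^sup>+ \<omega>'. F (gw_tree \<omega>) * (G (gw_tree \<omega>') * indicator {T. v \<in> T} (gw_tree \<omega>'))
      \<partial>offspring q \<partial>offspring q)"
    by (subst P.nn_integral_fst[symmetric]) (simp_all add: pt)
  also have "\<dots> = (\<integral>\<^sup>+ \<omega>. F (gw_tree \<omega>) \<partial>offspring q)
      * (\<integral>\<^sup>+ \<omega>. G (gw_tree \<omega>) * indicator {T. v \<in> T} (gw_tree \<omega>) \<partial>offspring q)"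
    by (simp add: nn_integral_cmult nn_integral_multc)
  also have "\<dots> = (\<integral>\<^sup>+ T. F T \<partial>GW q) * (\<integral>\<^sup>+ T. G T * indicator {T. v \<in> T} T \<partial>GW q)"
    unfolding GW_def by (subst (1 2) nn_integral_distr) measurable
  finally show ?thesis .
qed

text \<open>This is \<open>branching\<close> with \<open>F\<close> the indicator of a measurable
  null set containing all failures of \<open>Q\<close>, combined over the countably many
  vertices.\<close>

lemma AE_subtree:
  assumes "AE T in GW q. Q T"
  shows "AE T in GW q. \<forall>v\<in>T. Q (subtree T v)"
proof -
  obtain N where N: "N \<in> sets (GW q)" "emeasure (GW q) N = 0" "\<And>T. rooted_tree T \<Longrightarrow> T \<notin> N \<Longrightarrow> Q T"
    using assms by (rule AE_E) (auto simp: space_GW)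
  have [measurable]: "N \<in> sets tree_space" using N(1) by (simp add: sets_GW)
  have "AE T in GW q. v \<in> T \<longrightarrow> Q (subtree T v)" for v
  proof -
    have "(\<integral>\<^sup>+ T. indicator N (subtree T v) * 1 * indicator {T. v \<in> T} T \<partial>GW q) = 0"
      using N by (subst branching) auto
    then have "AE T in GW q. indicator N (subtree T v) * 1 * indicator {T. v \<in> T} T = (0 :: ennreal)"
      by (subst (asm) nn_integral_0_iff_AE) auto
    with AE_space show ?thesis
      by eventually_elim
        (auto simp: space_GW intro!: N(3) rooted_tree_subtree split: split_indicator_asm)
  qed
  then have "AE T in GW q. \<forall>v. v \<in> T \<longrightarrow> Q (subtree T v)"
    by (simp add: AE_all_countable)
  then show ?thesis by eventually_elim blast
qed

section \<open>Regular trees\<close>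

text \<open>An event of full measure on which \<open>W_inf\<close> is a genuine positive limit at
  every vertex, so that the identities for \<open>W_inf\<close> can be proved tree by tree.\<close>

definition regular :: "(nat \<Rightarrow> real) \<Rightarrow> tree \<Rightarrow> bool" where
  "regular c T \<longleftrightarrow> rooted_tree T
     \<and> (\<forall>u\<in>T. \<exists>L>0. (\<lambda>k. real (gen_size T k u) / c k) \<longlonglongrightarrow> L)"

lemma regular_rooted: "regular c T \<Longrightarrow> rooted_tree T"
  by (simp add: regular_def)

lemma regular_root: "regular c T \<Longrightarrow> [] \<in> T"
  by (simp add: regular_def rooted_tree_def)

lemma regular_limit:
  assumes "regular c T" "u \<in> T"
  shows "(\<lambda>k. real (gen_size T k u) / c k) \<longlonglongrightarrow> W_inf c T u" "0 < W_inf c T u"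
  using assms unfolding regular_def W_inf_def by (metis limI)+

text \<open>Divide \<open>gen_size_add\<close> by \<open>c n\<close> and let \<open>n\<close> grow:
  normalising by \<open>c n\<close> instead of \<open>c (n + d)\<close> contributes the factor
  \<open>m ^ d\<close>.\<close>

lemma sum_W_inf_desc:
  assumes T: "regular c T" "u \<in> T" and c: "(\<lambda>n. c (Suc n) / c n) \<longlonglongrightarrow> m" and m: "1 < m"
  shows "(\<Sum>v\<in>desc T u d. W_inf c T v) = m ^ d * W_inf c T u"
proof -
  \<comment> \<open>Since \<open>x / 0 = 0\<close>, a positive ratio forces
    \<open>c n \<noteq> 0\<close>.\<close>
  have "eventually (\<lambda>n. c (Suc n) / c n > 0) sequentially"
    using c m by (intro order_tendstoD(1)[OF c]) auto
  then have ev: "eventually (\<lambda>n. c n \<noteq> 0) sequentially"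
    by eventually_elim auto
  have ratio: "(\<lambda>n. c (n + d) / c n) \<longlonglongrightarrow> m ^ d"
  proof (induction d)
    case 0
    have "(\<lambda>n. c (n + 0) / c n) \<longlonglongrightarrow> 1"
      by (rule Lim_transform_eventually[OF tendsto_const]) (use ev in eventually_elim, auto)
    then show ?case by simp
  next
    case (Suc d)
    have ev': "eventually (\<lambda>n. c (n + d) \<noteq> 0) sequentially"
      using ev by (rule sequentially_offset)
    have "(\<lambda>n. c (Suc (n + d)) / c (n + d) * (c (n + d) / c n)) \<longlonglongrightarrow> m * m ^ d"
      using LIMSEQ_ignore_initial_segment[OF c, of d] Suc by (rule tendsto_mult)
    then have "(\<lambda>n. c (n + Suc d) / c n) \<longlonglongrightarrow> m * m ^ d"
      by (rule Lim_transform_eventually) (use ev' in eventually_elim, auto)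
    then show ?case by simp
  qed
  have ev': "eventually (\<lambda>n. c (n + d) \<noteq> 0) sequentially"
    using ev by (rule sequentially_offset)
  have "(\<lambda>n. real (gen_size T (n + d) u) / c (n + d) * (c (n + d) / c n)) \<longlonglongrightarrow> W_inf c T u * m ^ d"
    using LIMSEQ_ignore_initial_segment[OF regular_limit(1)[OF T], of d] ratio by (rule tendsto_mult)
  then have "(\<lambda>n. real (gen_size T (d + n) u) / c n) \<longlonglongrightarrow> W_inf c T u * m ^ d"
    by (rule Lim_transform_eventually) (use ev' in eventually_elim, auto simp: add.commute)
  moreover have "(\<lambda>n. real (gen_size T (d + n) u) / c n) \<longlonglongrightarrow> (\<Sum>v\<in>desc T u d. W_inf c T v)"
    unfolding gen_size_add[OF regular_rooted[OF T(1)]] of_nat_sum sum_divide_distrib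
    by (intro tendsto_sum regular_limit T) (auto simp: desc_def)
  ultimately show ?thesis
    using LIMSEQ_unique by (metis mult.commute)
qed

lemma AE_regular:
  assumes "AE T in GW q. \<exists>L>0. (\<lambda>n. real (gen_size T n []) / c n) \<longlonglongrightarrow> L"
  shows "AE T in GW q. regular c T"
  using AE_subtree[OF assms] AE_space
proof eventually_elim
  case (elim T)
  have "\<exists>L>0. (\<lambda>n. real (gen_size T n u) / c n) \<longlonglongrightarrow> L" if "u \<in> T" for u
  proof -
    from elim(1) that
    have "\<exists>L>0. (\<lambda>n. real (gen_size (subtree T u) n []) / c n) \<longlonglongrightarrow> L" by blast
    then show ?thesis by (simp only: gen_size_subtree[OF that, of _ "[]", unfolded append_Nil2])
  qed
  then show ?case using elim(2) by (simp add: regular_def space_GW)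
qed

section \<open>A sequence on which a slowly growing function keeps growing\<close>

lemma prod_residue_classes:
  fixes x :: "nat \<Rightarrow> 'a :: comm_monoid_mult"
  shows "(\<Prod>r<p. \<Prod>j<k. x (r + j * p)) = (\<Prod>i<k * p. x i)"
proof -
  have "(\<Prod>i<k * p. x i) = (\<Prod>j<k. \<Prod>i\<in>{j * p..<j * p + p}. x i)"
    by (rule prod.nat_group[symmetric])
  also have "\<dots> = (\<Prod>j<k. \<Prod>r<p. x (r + j * p))"
  proof (rule prod.cong[OF refl])
    fix j
    show "(\<Prod>i\<in>{j * p..<j * p + p}. x i) = (\<Prod>r<p. x (r + j * p))"
      by (rule prod.reindex_bij_witness[of _ "\<lambda>r. r + j * p" "\<lambda>i. i - j * p"]) auto
  qed
  finally show ?thesis by (subst prod.swap) simp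
qed

text \<open>The product over a sequence with small steps telescopes; splitting its indices into
  residue classes gives finitely many products, one of which must also vanish.\<close>

lemma exists_doubling_sequence:
  fixes f :: "nat \<Rightarrow> real"
  assumes mono: "mono f" and pos: "\<And>n. N \<le> n \<Longrightarrow> 0 < f n" and lim: "filterlim f at_top sequentially"
    and A: "0 < A"
  obtains s where "N \<le> s 0" "\<And>j. 2 * s j \<le> s (Suc j)" "\<And>j. 0 < s j"
    "(\<lambda>k. \<Prod>j<k. f (A * s j) / f ((A + 1) * s j)) \<longlonglongrightarrow> 0"
proof -
  \<comment> \<open>Each step multiplies by at most \<open>1 + 1 / A\<close>, which gives
    \<open>\<sigma>_step\<close>. Starting at \<open>2 * A\<close> or more limits the rounding loss
    of \<open>div\<close> to one half, so that \<open>2 * A\<close> steps at least double the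
    value.\<close>
  define \<sigma> where "\<sigma> = rec_nat (N + 2 * A) (\<lambda>_ x. x + x div A)"
  have \<sigma>_Suc: "\<sigma> (Suc i) = \<sigma> i + \<sigma> i div A" and \<sigma>_0: "\<sigma> 0 = N + 2 * A" for i
    by (simp_all add: \<sigma>_def)
  have \<sigma>_mono: "mono \<sigma>" by (rule mono_iff_le_Suc[THEN iffD2]) (simp add: \<sigma>_Suc)
  have \<sigma>_ge: "N + 2 * A \<le> \<sigma> i" for i using monoD[OF \<sigma>_mono, of 0 i] \<sigma>_0 by simp
  have \<sigma>_step: "A * \<sigma> (Suc i) \<le> (A + 1) * \<sigma> i" for i
    by (simp add: \<sigma>_Suc algebra_simps)
  have \<sigma>_add: "\<sigma> i + j * (\<sigma> i div A) \<le> \<sigma> (i + j)" for i j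
  proof (induction j)
    case (Suc j)
    have "\<sigma> i div A \<le> \<sigma> (i + j) div A" using \<sigma>_mono by (simp add: div_le_mono monoD)
    then show ?case using Suc by (simp add: \<sigma>_Suc)
  qed simp
  have double: "2 * \<sigma> i \<le> \<sigma> (i + 2 * A)" for i
  proof -
    have "A * (\<sigma> i div A) + \<sigma> i mod A = \<sigma> i" "\<sigma> i mod A < A" using A by auto
    then have "\<sigma> i \<le> 2 * (A * (\<sigma> i div A))" using \<sigma>_ge[of i] by linarith
    then show ?thesis using \<sigma>_add[of i "2 * A"] by (simp add: mult.assoc)
  qed
  have \<sigma>_gt: "i \<le> \<sigma> i" for i
  proof (induction i)
    case (Suc i)
    have "1 \<le> \<sigma> i div A" using \<sigma>_ge[of i] A by (simp add: Suc_le_eq div_greater_zero_iff)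
    then show ?case using Suc by (simp add: \<sigma>_Suc)
  qed simp
  have N_le: "N \<le> A * \<sigma> i" for i
  proof -
    have "1 * N \<le> A * \<sigma> i" using A \<sigma>_ge[of i] by (intro mult_le_mono) auto
    then show ?thesis by simp
  qed
  define x where "x i = f (A * \<sigma> i) / f ((A + 1) * \<sigma> i)" for i
  have x01: "0 < x i" "x i \<le> 1" for i
  proof -
    have "N \<le> (A + 1) * \<sigma> i" using N_le[of i] by simp
    then show "0 < x i" "x i \<le> 1" using pos N_le[of i] monoD[OF mono, of "A * \<sigma> i" "(A + 1) * \<sigma> i"]
      by (simp_all add: x_def)
  qed
  have x_le: "x i \<le> f (A * \<sigma> i) / f (A * \<sigma> (Suc i))" for i
    unfolding x_def
  proof (rule divide_left_mono)
    have "N \<le> (A + 1) * \<sigma> i" using N_le[of i] by simp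
    then show "0 < f ((A + 1) * \<sigma> i) * f (A * \<sigma> (Suc i))" "0 \<le> f (A * \<sigma> i)"
      using pos N_le by (simp_all add: less_imp_le)
  qed (rule monoD[OF mono \<sigma>_step])
  have le: "(\<Prod>i<n. x i) \<le> f (A * \<sigma> 0) / f (A * \<sigma> n)" for n
  proof (induction n)
    case 0
    show ?case using pos[OF N_le, of 0] by simp
  next
    case (Suc n)
    have "(\<Prod>i<Suc n. x i) \<le> f (A * \<sigma> 0) / f (A * \<sigma> n) * (f (A * \<sigma> n) / f (A * \<sigma> (Suc n)))"
      unfolding prod.lessThan_Suc
      using pos[OF N_le, of 0] pos[OF N_le, of n] x01(1)[of n]
      by (intro mult_mono Suc x_le) auto
    then show ?case using pos[OF N_le, of n] by simp
  qed
  have "filterlim (\<lambda>n. f (A * \<sigma> n)) at_top sequentially"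
  proof (rule filterlim_compose[OF lim])
    have "n \<le> A * \<sigma> n" for n
    proof -
      have "1 * n \<le> A * \<sigma> n" using A \<sigma>_gt[of n] by (intro mult_le_mono) auto
      then show ?thesis by simp
    qed
    then show "filterlim (\<lambda>n. A * \<sigma> n) at_top sequentially"
      by (intro filterlim_at_top_mono[OF filterlim_ident]) auto
  qed
  then have "(\<lambda>n. f (A * \<sigma> 0) / f (A * \<sigma> n)) \<longlonglongrightarrow> 0"
    by (intro tendsto_divide_0[OF tendsto_const] filterlim_at_top_imp_at_infinity)
  then have x_lim: "(\<lambda>n. \<Prod>i<n. x i) \<longlonglongrightarrow> 0"
    by (rule tendsto_sandwich[OF _ _ tendsto_const, rotated 2])
      (auto intro!: always_eventually le prod_nonneg simp: x01 less_imp_le)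
  \<comment> \<open>Along the indices congruent to \<open>r\<close> modulo \<open>2 * A\<close> the
    sequence \<open>\<sigma>\<close> at least doubles. Each \<open>P r\<close> decreases within
    [0, 1], hence converges, so the limit of the full product is the product of these
    limits.\<close>
  define P where "P r k = (\<Prod>j<k. x (r + j * (2 * A)))" for r k
  have P_conv: "convergent (P r)" for r
  proof (rule Bseq_monoseq_convergent)
    have P01: "0 \<le> P r k" "P r k \<le> 1" for k
      unfolding P_def by (auto intro!: prod_nonneg prod_le_1 simp: x01 less_imp_le)
    then show "Bseq (P r)" by (intro BseqI'[of _ 1]) auto
    have "P r (Suc k) \<le> P r k" for k
      using mult_left_le[OF x01(2) P01(1)] by (simp add: P_def)
    then show "monoseq (P r)" by (simp add: monoseq_Suc)
  qed
  have "(\<lambda>k. \<Prod>r<2 * A. P r k) \<longlonglongrightarrow> (\<Prod>r<2 * A. lim (P r))"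
    using P_conv by (intro tendsto_prod) (simp add: convergent_LIMSEQ_iff)
  moreover have "(\<lambda>k. \<Prod>r<2 * A. P r k) \<longlonglongrightarrow> 0"
  proof -
    have "filterlim (\<lambda>k. k * (2 * A)) at_top sequentially"
      using A by (intro filterlim_at_top_mono[OF filterlim_ident]) (auto intro!: always_eventually)
    from filterlim_compose[OF x_lim this] show ?thesis by (simp add: P_def prod_residue_classes)
  qed
  ultimately have "(\<Prod>r<2 * A. lim (P r)) = 0" by (rule LIMSEQ_unique)
  then obtain r where "lim (P r) = 0" by auto
  then have "P r \<longlonglongrightarrow> 0" using P_conv[of r] by (simp add: convergent_LIMSEQ_iff)
  show ?thesis
  proof (rule that[of "\<lambda>j. \<sigma> (r + j * (2 * A))"])
    show "N \<le> \<sigma> (r + 0 * (2 * A))" using \<sigma>_ge[of "r + 0 * (2 * A)"] by linarith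
    show "0 < \<sigma> (r + j * (2 * A))" for j using \<sigma>_ge[of "r + j * (2 * A)"] A by linarith
    show "2 * \<sigma> (r + j * (2 * A)) \<le> \<sigma> (r + Suc j * (2 * A))" for j
      using double[of "r + j * (2 * A)"] by (simp add: algebra_simps)
    show "(\<lambda>k. \<Prod>j<k. f (A * \<sigma> (r + j * (2 * A))) / f ((A + 1) * \<sigma> (r + j * (2 * A)))) \<longlonglongrightarrow> 0"
      using \<open>P r \<longlonglongrightarrow> 0\<close> by (simp only: P_def[abs_def] x_def)
  qed
qed

section \<open>The limit variable and its truncated mean\<close>

definition W :: "(nat \<Rightarrow> real) \<Rightarrow> tree \<Rightarrow> ennreal" where
  "W c T = ennreal (W_inf c T [])"

text \<open>The cousin mass \<open>R\<close> of the overview: every other vertex at the level of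
  \<open>v\<close> counts, not only those with the same parent.\<close>

definition siblings :: "(nat \<Rightarrow> real) \<Rightarrow> tree \<Rightarrow> vertex \<Rightarrow> ennreal" where
  "siblings c T v = (\<Sum>u\<in>level T (length v). if u = v then 0 else W c (subtree T u))"

text \<open>The function \<open>L\<close> of the overview.\<close>

definition trunc_mean :: "nat pmf \<Rightarrow> (nat \<Rightarrow> real) \<Rightarrow> ennreal \<Rightarrow> ennreal" where
  "trunc_mean q c x = (\<integral>\<^sup>+ T. W c T * indicator {T. W c T < x} T \<partial>GW q)"

text \<open>Up to the factor \<open>m ^ d\<close>, \<open>spine q c d y\<close> is the probability that the sibling mass at level
  \<open>d\<close> of the spine of a size-biased tree is less than \<open>y\<close>.\<close>

definition spine :: "nat pmf \<Rightarrow> (nat \<Rightarrow> real) \<Rightarrow> nat \<Rightarrow> ennreal \<Rightarrow> ennreal" where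
  "spine q c d y = (\<integral>\<^sup>+ T. (\<Sum>v\<in>level T d. indicator {T. siblings c T v < y} T) \<partial>GW q)"

lemma measurable_W [measurable]: "W c \<in> borel_measurable tree_space"
  unfolding W_def[abs_def] by measurable

lemma measurable_siblings [measurable]: "(\<lambda>T. siblings c T v) \<in> borel_measurable tree_space"
  unfolding siblings_def by measurable

lemma subtree_cong:
  assumes agree: "\<And>u. \<not> strict_prefix v u \<Longrightarrow> u \<in> T \<longleftrightarrow> u \<in> T'"
    and "length u = length v" "u \<noteq> v"
  shows "subtree T u = subtree T' u"
proof -
  have "\<not> strict_prefix v (u @ x)" for x
    using assms(2,3) by (auto simp: strict_prefix_def prefix_def)
  from this[of "[]"] this show ?thesis by (simp add: subtree_def agree)
qed

lemma level_cong:
  assumes "\<And>u. \<not> strict_prefix v u \<Longrightarrow> u \<in> T \<longleftrightarrow> u \<in> T'" and "d \<le> length v"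
  shows "level T d = level T' d"
proof -
  have "\<not> strict_prefix v u" if "length u = d" for u
    using assms(2) that by (auto dest: prefix_length_less)
  then show ?thesis using assms(1) by (auto simp: desc_def)
qed

text \<open>The subtrees at the other vertices of the level contain nothing strictly below
  \<open>v\<close>. This supplies the locality hypothesis of \<open>branching\<close>.\<close>

lemma siblings_cong:
  assumes "\<And>u. \<not> strict_prefix v u \<Longrightarrow> u \<in> T \<longleftrightarrow> u \<in> T'"
  shows "siblings c T v = siblings c T' v"
  unfolding siblings_def
  by (intro sum.cong level_cong[OF assms]) (auto simp: mem_level intro: arg_cong[OF subtree_cong[OF assms]])

text \<open>For fixed \<open>v\<close> the subtree is independent of the cousin mass; summing over
  the level produces the spine weight. This stands in for a change to the size-biased law.\<close>

lemma spine_factor: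
  assumes F [measurable]: "F \<in> borel_measurable tree_space"
  shows "(\<integral>\<^sup>+ T. (\<Sum>v\<in>level T d. F (subtree T v) * indicator {T. siblings c T v < y} T) \<partial>GW q)
    = (\<integral>\<^sup>+ T. F T \<partial>GW q) * spine q c d y"
proof -
  have "(\<integral>\<^sup>+ T. F (subtree T v) * indicator {T. siblings c T v < y} T * indicator {T. v \<in> T} T \<partial>GW q)
      = (\<integral>\<^sup>+ T. F T \<partial>GW q) * (\<integral>\<^sup>+ T. indicator {T. siblings c T v < y} T * indicator {T. v \<in> T} T \<partial>GW q)"
    for v
  proof (rule branching)
    fix T T'
    assume "\<And>u. \<not> strict_prefix v u \<Longrightarrow> u \<in> T \<longleftrightarrow> u \<in> T'"
    from siblings_cong[OF this]
    show "indicator {T. siblings c T v < y} T = (indicator {T. siblings c T v < y} T' :: ennreal)"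
      by (simp add: indicator_def)
  qed measurable
  then show ?thesis
    unfolding spine_def by (subst (1 2) nn_integral_sum_level) (auto simp: sets_GW nn_integral_cmult)
qed

section \<open>Inequalities for the truncated mean along a size-biased line\<close>

locale seneta_heyde =
  fixes q :: "nat pmf" and m :: real and c :: "nat \<Rightarrow> real"
  assumes m_def: "m = measure_pmf.expectation q real"
    and m_finite: "integrable (measure_pmf q) real"
    and m_gt_1: "1 < m"
    and norm_limit: "AE T in GW q. \<exists>L>0. (\<lambda>n. real (gen_size T n []) / c n) \<longlonglongrightarrow> L"
    and c_ratio: "(\<lambda>n. c (Suc n) / c n) \<longlonglongrightarrow> m"
    and nu_ln_nu: "(\<integral>\<^sup>+ k. ennreal (real k * ln (real k)) \<partial>measure_pmf q) = \<infinity>"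
begin

lemma sum_W_level:
  assumes T: "regular c T"
  shows "(\<Sum>v\<in>level T d. W c (subtree T v)) = ennreal (m ^ d) * W c T"
proof -
  have root: "[] \<in> T" using T by (simp add: regular_def rooted_tree_def)
  have pos: "0 \<le> W_inf c T v" if "v \<in> T" for v
    using regular_limit(2)[OF T that] by simp
  have "(\<Sum>v\<in>level T d. W c (subtree T v)) = (\<Sum>v\<in>level T d. ennreal (W_inf c T v))"
    unfolding W_def by (intro sum.cong) (auto simp: mem_level W_inf_subtree)
  also have "\<dots> = ennreal (m ^ d * W_inf c T [])"
    using sum_W_inf_desc[OF T root c_ratio m_gt_1] pos by (subst sum_ennreal) (auto simp: mem_level)
  also have "\<dots> = ennreal (m ^ d) * W c T"
    using m_gt_1 by (simp add: W_def ennreal_mult')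
  finally show ?thesis .
qed

lemma W_siblings:
  assumes T: "regular c T" and v: "v \<in> level T d"
  shows "W c (subtree T v) + siblings c T v = ennreal (m ^ d) * W c T"
proof -
  have len: "length v = d" using v by (simp add: mem_level)
  have "(\<Sum>u\<in>level T d. W c (subtree T u))
      = (\<Sum>u\<in>level T d. if u = v then W c (subtree T v) else 0) + siblings c T v"
    unfolding siblings_def len sum.distrib[symmetric] by (intro sum.cong) auto
  then show ?thesis
    using v finite_desc[OF regular_rooted[OF T]] by (simp add: sum_W_level[OF T])
qed

lemma AE_W_pos: "AE T in GW q. 0 < W c T"
  using AE_regular[OF norm_limit]
proof eventually_elim
  case (elim T)
  then have "[] \<in> T" by (simp add: regular_def rooted_tree_def)
  then show ?case using regular_limit(2)[OF elim] by (simp add: W_def)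
qed

lemma trunc_mean_le: "trunc_mean q c x \<le> x"
proof -
  interpret prob_space "GW q" by (rule prob_space_GW)
  have "trunc_mean q c x \<le> (\<integral>\<^sup>+ T. x \<partial>GW q)"
    unfolding trunc_mean_def by (intro nn_integral_mono) (auto simp: indicator_def)
  then show ?thesis by (simp add: emeasure_space_1)
qed

lemma trunc_mean_mono: "x \<le> y \<Longrightarrow> trunc_mean q c x \<le> trunc_mean q c y"
  unfolding trunc_mean_def by (intro nn_integral_mono) (auto simp: indicator_def)

text \<open>If \<open>W < y\<close> at a vertex and its cousins weigh less than \<open>y\<close>,
  then \<open>m ^ d * W < 2 * y\<close> at the root. Weighting by \<open>W\<close> of the vertex and
  summing over the level returns \<open>m ^ d * W\<close>.\<close>

lemma spine_le_trunc_mean: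
  assumes xy: "ennreal (m ^ d) * x = 2 * y"
  shows "spine q c d y * trunc_mean q c y \<le> ennreal (m ^ d) * trunc_mean q c x"
proof -
  let ?F = "\<lambda>T. W c T * indicator {T. W c T < y} T"
  have "spine q c d y * trunc_mean q c y
      = (\<integral>\<^sup>+ T. (\<Sum>v\<in>level T d. ?F (subtree T v) * indicator {T. siblings c T v < y} T) \<partial>GW q)"
    by (subst spine_factor) (simp_all add: trunc_mean_def mult.commute)
  also have "\<dots> \<le> (\<integral>\<^sup>+ T. ennreal (m ^ d) * (W c T * indicator {T. W c T < x} T) \<partial>GW q)"
  proof (rule nn_integral_mono_AE, use AE_regular[OF norm_limit] in eventually_elim)
    fix T assume T: "regular c T"
    have "?F (subtree T v) * indicator {T. siblings c T v < y} T
        \<le> W c (subtree T v) * indicator {T. W c T < x} T" if v: "v \<in> level T d" for v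
    proof (cases "W c (subtree T v) < y \<and> siblings c T v < y")
      case True
      then have "ennreal (m ^ d) * W c T < y + y"
        unfolding W_siblings[OF T v, symmetric] by (intro add_strict_mono) auto
      then have "ennreal (m ^ d) * W c T < ennreal (m ^ d) * x" by (simp add: xy mult_2)
      then have "W c T < x" by (meson leD leI mult_left_mono zero_le)
      then show ?thesis by (simp add: indicator_def)
    qed (auto simp: indicator_def)
    then have "(\<Sum>v\<in>level T d. ?F (subtree T v) * indicator {T. siblings c T v < y} T)
        \<le> (\<Sum>v\<in>level T d. W c (subtree T v) * indicator {T. W c T < x} T)"
      by (rule sum_mono)
    also have "\<dots> = ennreal (m ^ d) * (W c T * indicator {T. W c T < x} T)"
      by (simp add: sum_W_level[OF T] mult.assoc flip: sum_distrib_right)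
    finally show "(\<Sum>v\<in>level T d. ?F (subtree T v) * indicator {T. siblings c T v < y} T)
        \<le> ennreal (m ^ d) * (W c T * indicator {T. W c T < x} T)" .
  qed
  also have "\<dots> = ennreal (m ^ d) * trunc_mean q c x"
    unfolding trunc_mean_def by (rule nn_integral_cmult) measurable
  finally show ?thesis .
qed

text \<open>The reverse use of the decomposition: \<open>W < x\<close> at the root bounds both the
  share of a child and that of its siblings by \<open>m * x\<close>.\<close>

lemma trunc_mean_le_spine:
  "ennreal m * trunc_mean q c x \<le> trunc_mean q c (ennreal m * x) * spine q c 1 (ennreal m * x)"
proof -
  let ?y = "ennreal m * x"
  let ?F = "\<lambda>T. W c T * indicator {T. W c T < ?y} T"
  have "ennreal m * trunc_mean q c x = (\<integral>\<^sup>+ T. ennreal m * (W c T * indicator {T. W c T < x} T) \<partial>GW q)"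
    unfolding trunc_mean_def by (rule nn_integral_cmult[symmetric]) measurable
  also have "\<dots> \<le> (\<integral>\<^sup>+ T. (\<Sum>v\<in>level T 1. ?F (subtree T v) * indicator {T. siblings c T v < ?y} T) \<partial>GW q)"
  proof (rule nn_integral_mono_AE, use AE_regular[OF norm_limit] in eventually_elim)
    fix T assume T: "regular c T"
    have "ennreal m * (W c T * indicator {T. W c T < x} T)
        = (\<Sum>v\<in>level T 1. W c (subtree T v) * indicator {T. W c T < x} T)"
      using sum_W_level[OF T, of 1] by (simp add: mult.assoc flip: sum_distrib_right)
    also have "\<dots> \<le> (\<Sum>v\<in>level T 1. ?F (subtree T v) * indicator {T. siblings c T v < ?y} T)"
    proof (rule sum_mono)
      fix v assume v: "v \<in> level T 1"
      show "W c (subtree T v) * indicator {T. W c T < x} T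
        \<le> ?F (subtree T v) * indicator {T. siblings c T v < ?y} T"
      proof (cases "W c T < x")
        case True
        then have lt: "ennreal m * W c T < ?y"
          using m_gt_1 by (intro ennreal_mult_strict_left_mono) auto
        have eq: "W c (subtree T v) + siblings c T v = ennreal m * W c T"
          using W_siblings[OF T v] by simp
        have "W c (subtree T v) \<le> ennreal m * W c T" "siblings c T v \<le> ennreal m * W c T"
          unfolding eq[symmetric] by simp_all
        then show ?thesis using lt by (auto simp: indicator_def)
      qed (auto simp: indicator_def)
    qed
    finally show "ennreal m * (W c T * indicator {T. W c T < x} T)
        \<le> (\<Sum>v\<in>level T 1. ?F (subtree T v) * indicator {T. siblings c T v < ?y} T)" .
  qed
  also have "\<dots> = trunc_mean q c ?y * spine q c 1 ?y"
    by (subst spine_factor) (simp_all add: trunc_mean_def)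
  finally show ?thesis .
qed

section \<open>The limit variable has infinite mean\<close>

lemma card_level_1: "card (level (gw_tree \<omega>) 1) = \<omega> []"
proof -
  have "level (gw_tree \<omega>) 1 = (\<lambda>k. [k]) ` {..<\<omega> []}"
    unfolding desc_1 by (auto simp: gw_tree_def)
  then show ?thesis by (simp add: card_image inj_on_def)
qed

lemma measurable_card_level [measurable]:
  "(\<lambda>T. card (level T d)) \<in> measurable tree_space (count_space UNIV)"
proof -
  have "(\<lambda>T. nat \<lfloor>real (gen_size T d [])\<rfloor>) \<in> measurable tree_space (count_space UNIV)"
    by measurable
  then show ?thesis by (simp add: gen_size_eq_card)
qed

lemma nn_integral_card_level_1:
  fixes h :: "nat \<Rightarrow> ennreal"
  shows "(\<integral>\<^sup>+ T. h (card (level T 1)) \<partial>GW q) = (\<integral>\<^sup>+ k. h k \<partial>measure_pmf q)"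
proof -
  interpret P: product_prob_space "\<lambda>_. measure_pmf q" "UNIV :: vertex set" by unfold_locales
  have "(\<integral>\<^sup>+ T. h (card (level T 1)) \<partial>GW q) = (\<integral>\<^sup>+ \<omega>. h (\<omega> []) \<partial>offspring q)"
    unfolding GW_def by (subst nn_integral_distr[OF measurable_gw_tree]) (simp_all only: card_level_1, measurable)
  also have "\<dots> = (\<integral>\<^sup>+ k. h k \<partial>distr (offspring q) (measure_pmf q) (\<lambda>\<omega>. \<omega> []))"
    by (rule nn_integral_distr[symmetric]) measurable
  also have "distr (offspring q) (measure_pmf q) (\<lambda>\<omega>. \<omega> []) = measure_pmf q"
    by (rule P.PiM_component) simp
  finally show ?thesis .
qed

lemma nn_integral_offspring: "(\<integral>\<^sup>+ k. of_nat k \<partial>measure_pmf q) = ennreal m"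
  using nn_integral_eq_integral[OF m_finite] by (simp add: m_def ennreal_of_nat_eq_real_of_nat)

text \<open>Continuity from above, as \<open>W\<close> is almost surely positive. The value 1/4 is
  doubled in \<open>spine_1_le\<close> and leaves the factor 1/2 there.\<close>

lemma exists_small_W:
  obtains \<eta> :: real where "0 < \<eta>" "emeasure (GW q) {T\<in>space (GW q). W c T < ennreal \<eta>} \<le> ennreal (1 / 4)"
proof -
  interpret prob_space "GW q" by (rule prob_space_GW)
  let ?A = "\<lambda>n. {T\<in>space (GW q). W c T < ennreal (1 / real (Suc n))}"
  have "(\<lambda>n. emeasure (GW q) (?A n)) \<longlonglongrightarrow> emeasure (GW q) (\<Inter>n. ?A n)"
  proof (rule Lim_emeasure_decseq)
    show "decseq ?A"
      unfolding decseq_def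
    proof (intro allI impI)
      fix k n :: nat assume "k \<le> n"
      then have "ennreal (1 / real (Suc n)) \<le> ennreal (1 / real (Suc k))"
        by (intro ennreal_leI) (simp add: frac_le)
      then show "?A n \<subseteq> ?A k" by (auto intro: less_le_trans)
    qed
  qed auto
  also have "emeasure (GW q) (\<Inter>n. ?A n) = 0"
  proof -
    have "(\<Inter>n. ?A n) \<subseteq> {T\<in>space (GW q). \<not> 0 < W c T}"
    proof
      fix T assume T: "T \<in> (\<Inter>n. ?A n)"
      show "T \<in> {T\<in>space (GW q). \<not> 0 < W c T}"
      proof (rule ccontr)
        assume "T \<notin> {T\<in>space (GW q). \<not> 0 < W c T}"
        then have "0 < W_inf c T []" using T by (auto simp: W_def)
        then obtain n where "1 / real (Suc n) < W_inf c T []" using nat_approx_posE by blast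
        moreover have "W_inf c T [] < 1 / real (Suc n)"
          using T \<open>0 < W_inf c T []\<close> by (auto simp: W_def ennreal_less_iff simp del: of_nat_Suc)
        ultimately show False by simp
      qed
    qed
    moreover have meas: "{T\<in>space (GW q). \<not> 0 < W c T} \<in> sets (GW q)" by measurable
    moreover have "emeasure (GW q) {T\<in>space (GW q). \<not> 0 < W c T} = 0"
      using AE_iff_measurable[OF meas refl] AE_W_pos by blast
    ultimately have "emeasure (GW q) (\<Inter>n. ?A n) \<le> 0"
      using emeasure_mono[of "\<Inter>n. ?A n" "{T\<in>space (GW q). \<not> 0 < W c T}" "GW q"] meas by simp
    then show ?thesis by simp
  qed
  finally have "eventually (\<lambda>n. emeasure (GW q) (?A n) < ennreal (1 / 4)) sequentially"
    by (rule order_tendstoD(2)) simp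
  then obtain n where "emeasure (GW q) (?A n) < ennreal (1 / 4)"
    by (auto simp: eventually_sequentially)
  then show ?thesis using that[of "1 / real (Suc n)"] by simp
qed

end

context seneta_heyde
begin

text \<open>Call a child with \<open>W < \<eta>\<close> bad. If at most half of \<open>k\<close>
  children are bad, the siblings of any child weigh at least \<open>\<eta> * (k / 2 - 1)\<close>,
  hence at least \<open>y\<close> on the event of the indicator. Otherwise \<open>k\<close> is less
  than twice the number of bad children, and a child is bad with probability at most 1/4. The
  integral stands on both sides to avoid subtraction in \<open>ennreal\<close>.\<close>

lemma spine_1_le:
  assumes \<eta>: "0 < \<eta>" "emeasure (GW q) {T\<in>space (GW q). W c T < ennreal \<eta>} \<le> ennreal (1 / 4)"
    and y: "0 < y"
  shows "(\<integral>\<^sup>+ k. indicator {k. y \<le> \<eta> * (real k / 2 - 1)} k * of_nat k \<partial>measure_pmf q) + spine q c 1 (ennreal y)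
    \<le> ennreal m + ennreal (1 / 2) * (\<integral>\<^sup>+ k. indicator {k. y \<le> \<eta> * (real k / 2 - 1)} k * of_nat k \<partial>measure_pmf q)"
proof -
  define h :: "nat \<Rightarrow> ennreal" where "h k = indicator {k. y \<le> \<eta> * (real k / 2 - 1)} k" for k
  define F :: "tree \<Rightarrow> ennreal" where "F = indicator {T. W c T < ennreal \<eta>}"
  let ?C = "\<lambda>T. card (level T 1)"
  let ?S = "\<lambda>T. \<Sum>v\<in>level T 1. indicator {T. siblings c T v < ennreal y} T :: ennreal"
  have [measurable]: "F \<in> borel_measurable tree_space"
    unfolding F_def by measurable
  have [measurable]: "(\<lambda>T. h (?C T)) \<in> borel_measurable tree_space"
    by measurable
  have pointwise: "h (?C T) * of_nat (?C T) + ?S T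
      \<le> of_nat (?C T) + 2 * (\<Sum>v\<in>level T 1. F (subtree T v) * h (?C T))"
    if T: "rooted_tree T" for T
  proof -
    have fin: "finite (level T 1)" using T by (rule finite_desc)
    define B where "B = {v\<in>level T 1. W c (subtree T v) < ennreal \<eta>}"
    have fB: "finite B" "B \<subseteq> level T 1" using fin by (auto simp: B_def)
    have S_le: "?S T \<le> of_nat (?C T)"
      using sum_mono[of "level T 1" "\<lambda>v. indicator {T. siblings c T v < ennreal y} T :: ennreal" "\<lambda>_. 1"]
      by (simp add: indicator_def)
    have sumF: "(\<Sum>v\<in>level T 1. F (subtree T v)) = of_nat (card B)"
    proof -
      have "(\<Sum>v\<in>level T 1. F (subtree T v)) = (\<Sum>v\<in>B. 1)"
        using fin by (intro sum.mono_neutral_cong_right) (auto simp: B_def F_def)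
      then show ?thesis by simp
    qed
    show ?thesis
    proof (cases "y \<le> \<eta> * (real (?C T) / 2 - 1)")
      case False
      then show ?thesis using S_le by (simp add: h_def)
    next
      case True
      then have h1: "h (?C T) = 1" by (simp add: h_def)
      have "?S T \<le> 2 * of_nat (card B)"
      proof (cases "2 * card B \<le> ?C T")
        case False
        then have "of_nat (?C T) \<le> (of_nat (2 * card B) :: ennreal)" by (intro of_nat_mono) simp
        then show ?thesis using S_le by simp
      next
        case B: True
        have "\<not> siblings c T v < ennreal y" if v: "v \<in> level T 1" for v
        proof -
          \<comment> \<open>Children that are neither bad nor \<open>v\<close> itself; leaving out
            \<open>v\<close> causes the \<open>- 1\<close>.\<close>
          let ?G = "level T 1 - B - {v}"
          have "?C T - card B - 1 \<le> card ?G"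
            using diff_card_le_card_Diff[of "{v}" "level T 1 - B"] card_Diff_subset[OF fB] by simp
          then have "real (?C T) / 2 - 1 \<le> real (card ?G)" using B by linarith
          then have "\<eta> * (real (?C T) / 2 - 1) \<le> \<eta> * real (card ?G)"
            using \<eta>(1) by (intro mult_left_mono) auto
          then have "ennreal y \<le> ennreal (\<eta> * real (card ?G))" using True by (intro ennreal_leI) simp
          also have "\<dots> = (\<Sum>u\<in>?G. ennreal \<eta>)"
            using \<eta>(1) by (simp add: ennreal_mult' mult.commute ennreal_of_nat_eq_real_of_nat)
          also have "\<dots> \<le> (\<Sum>u\<in>?G. if u = v then 0 else W c (subtree T u))"
            by (intro sum_mono) (auto simp: B_def not_less)
          also have "\<dots> \<le> (\<Sum>u\<in>level T 1. if u = v then 0 else W c (subtree T u))"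
            using fin by (intro sum_mono2) auto
          finally show ?thesis using v by (simp add: siblings_def mem_level not_less)
        qed
        then have "?S T = 0" by (intro sum.neutral) auto
        then show ?thesis by simp
      qed
      then have "of_nat (?C T) + ?S T \<le> of_nat (?C T) + 2 * (\<Sum>v\<in>level T 1. F (subtree T v))"
        unfolding sumF by (rule add_left_mono)
      then show ?thesis by (simp only: h1 mult.left_neutral mult.right_neutral)
    qed
  qed
  let ?H = "\<integral>\<^sup>+ k. h k * of_nat k \<partial>measure_pmf q"
  have H: "(\<integral>\<^sup>+ T. h (?C T) * of_nat (?C T) \<partial>GW q) = ?H"
    using nn_integral_card_level_1[of "\<lambda>k. h k * of_nat k"] by simp
  \<comment> \<open>The number of children of the root is unaffected by what lies below a child, so
    \<open>branching\<close> applies.\<close>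
  have "(\<integral>\<^sup>+ T. F (subtree T v) * h (?C T) * indicator {T. v \<in> T} T \<partial>GW q)
     = (\<integral>\<^sup>+ T. F T \<partial>GW q) * (\<integral>\<^sup>+ T. h (?C T) * indicator {T. v \<in> T} T \<partial>GW q)"
    if v: "length v = 1" for v
  proof (rule branching)
    fix T T' assume "\<And>u. \<not> strict_prefix v u \<Longrightarrow> u \<in> T \<longleftrightarrow> u \<in> T'"
    from level_cong[OF this, where d = 1] v show "h (?C T) = h (?C T')" by simp
  qed measurable
  note factor = this
  have meas: "(\<lambda>T. F (subtree T v) * h (?C T)) \<in> borel_measurable tree_space"
    "(\<lambda>T. h (?C T)) \<in> borel_measurable tree_space" for v
    by measurable
  have "(\<integral>\<^sup>+ T. (\<Sum>v\<in>level T 1. F (subtree T v) * h (?C T)) \<partial>GW q)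
      = (\<integral>\<^sup>+ T. F T \<partial>GW q) * (\<integral>\<^sup>+ T. (\<Sum>v\<in>level T 1. h (?C T)) \<partial>GW q)"
    unfolding nn_integral_sum_level[OF meas(1) sets_GW] nn_integral_sum_level[OF meas(2) sets_GW]
    by (subst nn_integral_cmult[symmetric], simp, rule nn_integral_cong, rule factor) simp
  also have "(\<integral>\<^sup>+ T. (\<Sum>v\<in>level T 1. h (?C T)) \<partial>GW q) = ?H"
    by (simp flip: H) (simp only: mult.commute)
  also have "(\<integral>\<^sup>+ T. F T \<partial>GW q) = emeasure (GW q) {T\<in>space (GW q). W c T < ennreal \<eta>}"
  proof -
    have "(\<integral>\<^sup>+ T. F T \<partial>GW q) = (\<integral>\<^sup>+ T. indicator {T\<in>space (GW q). W c T < ennreal \<eta>} T \<partial>GW q)"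
      by (intro nn_integral_cong) (simp add: F_def indicator_def)
    also have "\<dots> = emeasure (GW q) {T\<in>space (GW q). W c T < ennreal \<eta>}"
      by (rule nn_integral_indicator) measurable
    finally show ?thesis .
  qed
  also have "\<dots> * ?H \<le> ennreal (1 / 4) * ?H"
    using \<eta>(2) by (rule mult_right_mono) simp
  finally have bad: "(\<integral>\<^sup>+ T. (\<Sum>v\<in>level T 1. F (subtree T v) * h (?C T)) \<partial>GW q) \<le> ennreal (1 / 4) * ?H" .
  have "?H + spine q c 1 (ennreal y) = (\<integral>\<^sup>+ T. h (?C T) * of_nat (?C T) + ?S T \<partial>GW q)"
    unfolding spine_def H[symmetric] by (rule nn_integral_add[symmetric]) measurable
  also have "\<dots> \<le> (\<integral>\<^sup>+ T. of_nat (?C T) + 2 * (\<Sum>v\<in>level T 1. F (subtree T v) * h (?C T)) \<partial>GW q)"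
    by (intro nn_integral_mono pointwise) (simp add: space_GW)
  also have "\<dots> = (\<integral>\<^sup>+ T. of_nat (?C T) \<partial>GW q) + 2 * (\<integral>\<^sup>+ T. (\<Sum>v\<in>level T 1. F (subtree T v) * h (?C T)) \<partial>GW q)"
    by (subst nn_integral_add) (auto simp: nn_integral_cmult)
  also have "\<dots> \<le> ennreal m + 2 * (ennreal (1 / 4) * ?H)"
    using nn_integral_card_level_1[of of_nat] nn_integral_offspring
    by (intro add_mono mult_left_mono bad) auto
  also have "2 * (ennreal (1 / 4) * ?H) = ennreal (1 / 2) * ?H"
  proof -
    have "2 * ennreal (1 / 4) = ennreal (1 / 2)" by (simp add: ennreal_mult'[symmetric] flip: ennreal_numeral)
    then show ?thesis by (simp flip: mult.assoc)
  qed
  finally show ?thesis by (simp add: h_def)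
qed

text \<open>For \<open>x = m ^ i\<close> the recursion \<open>trunc_mean_le_spine\<close> gains a factor \<open>1 - H i / (2 * m)\<close>;
  the series of the \<open>H i\<close> diverges because \<open>E (\<nu> ln \<nu>) = \<infinity>\<close>.\<close>

lemma nn_integral_W: "(\<integral>\<^sup>+ T. W c T \<partial>GW q) = \<infinity>"
proof (rule ccontr)
  assume "(\<integral>\<^sup>+ T. W c T \<partial>GW q) \<noteq> \<infinity>"
  then obtain K where K: "0 \<le> K" "(\<integral>\<^sup>+ T. W c T \<partial>GW q) = ennreal K"
    by (cases "\<integral>\<^sup>+ T. W c T \<partial>GW q" rule: ennreal_cases) auto
  obtain \<eta> where \<eta>: "0 < \<eta>" "emeasure (GW q) {T\<in>space (GW q). W c T < ennreal \<eta>} \<le> ennreal (1 / 4)"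
    by (rule exists_small_W)
  define h :: "nat \<Rightarrow> nat \<Rightarrow> ennreal" where "h i k = indicator {k. m ^ i \<le> \<eta> * (real k / 2 - 1)} k" for i k
  define H where "H i = enn2real (\<integral>\<^sup>+ k. h i k * of_nat k \<partial>measure_pmf q)" for i
  have H_le: "(\<integral>\<^sup>+ k. h i k * of_nat k \<partial>measure_pmf q) \<le> ennreal m" for i
    unfolding nn_integral_offspring[symmetric]
    by (intro nn_integral_mono) (auto simp: h_def indicator_def)
  have finite_by: "x = ennreal (enn2real x)" if "x \<le> ennreal r" for x r
    using that by (metis ennreal_enn2real ennreal_less_top le_less_trans)
  have H: "(\<integral>\<^sup>+ k. h i k * of_nat k \<partial>measure_pmf q) = ennreal (H i)" "0 \<le> H i" for i
    unfolding H_def using finite_by[OF H_le] by simp_all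
  have H_m: "H i \<le> m" for i using H_le[of i] H[of i] m_gt_1 by simp
  have not_summable: "\<not> summable H"
  proof
    assume "summable H"
    have "(\<integral>\<^sup>+ k. (\<Sum>i. h i k * of_nat k) \<partial>measure_pmf q) = (\<Sum>i. ennreal (H i))"
      by (subst nn_integral_suminf) (auto simp: H)
    also have "\<dots> < \<top>"
      using \<open>summable H\<close> H(2) by (simp add: suminf_ennreal2)
    finally have fin: "(\<integral>\<^sup>+ k. (\<Sum>i. h i k * of_nat k) \<partial>measure_pmf q) < \<top>" .
    have ln3: "0 \<le> ln (3 :: real)" by simp
    \<comment> \<open>The first summand comes from \<open>k / 6 \<le> k / 2 - 1\<close>, valid for
      \<open>k \<ge> 3\<close>; the second covers smaller \<open>k\<close>.\<close>
    define C where "C = \<bar>ln (6 / \<eta>)\<bar> + ln 3"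
    have C: "0 \<le> C" by (simp add: C_def)
    have "ennreal (real k * ln (real k)) \<le> ennreal C * of_nat k + ennreal (ln m) * (\<Sum>i. h i k * of_nat k)" for k
    proof -
      define z where "z = \<eta> * (real k / 2 - 1)"
      obtain j where "z < m ^ j" using real_arch_pow[OF m_gt_1] by blast
      \<comment> \<open>\<open>i0\<close> is the number of \<open>i\<close> with
        \<open>m ^ i \<le> z\<close>, roughly the logarithm of \<open>k\<close> to base
        \<open>m\<close>; this is how the sum over \<open>i\<close> recovers
        \<open>k * ln k\<close>.\<close>
      define i0 where "i0 = (LEAST i. z < m ^ i)"
      have i0: "z < m ^ i0" unfolding i0_def using \<open>z < m ^ j\<close> by (rule LeastI)
      have less_i0: "m ^ i \<le> z" if "i < i0" for i
        using not_less_Least[of i "\<lambda>i. z < m ^ i"] that by (simp add: i0_def not_less)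
      have "of_nat i0 * of_nat k = (\<Sum>i<i0. h i k * of_nat k)"
        using less_i0 by (simp add: h_def z_def)
      also have "\<dots> \<le> (\<Sum>i. h i k * of_nat k)" by (rule sum_le_suminf) auto
      finally have "ennreal (real i0 * real k) \<le> (\<Sum>i. h i k * of_nat k)"
        by (simp add: ennreal_mult ennreal_of_nat_eq_real_of_nat)
      then have i0_le: "ennreal (ln m) * ennreal (real i0 * real k) \<le> ennreal (ln m) * (\<Sum>i. h i k * of_nat k)"
        by (rule mult_left_mono) simp
      have "ln (real k) \<le> C + ln m * real i0"
      proof (cases "3 \<le> k")
        case True
        have "real k / 6 \<le> real k / 2 - 1" using True by simp
        then have "\<eta> * (real k / 6) \<le> z" unfolding z_def using \<eta>(1) by (intro mult_left_mono) auto
        then have "real k \<le> 6 / \<eta> * m ^ i0" using i0 \<eta>(1) by (simp add: field_simps)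
        then have "ln (real k) \<le> ln (6 / \<eta> * m ^ i0)" using True by simp
        also have "\<dots> = ln (6 / \<eta>) + ln m * real i0"
          using \<eta>(1) m_gt_1 by (subst ln_mult) (auto simp: ln_realpow)
        finally show ?thesis using abs_ge_self[of "ln (6 / \<eta>)"] ln3 unfolding C_def by linarith
      next
        case False
        then have "ln (real k) \<le> ln 3" by (cases "k = 0") auto
        moreover have "0 \<le> ln m * real i0" using m_gt_1 by simp
        ultimately show ?thesis by (simp add: C_def)
      qed
      then have "real k * ln (real k) \<le> real k * (C + ln m * real i0)"
        by (intro mult_left_mono) auto
      then have "real k * ln (real k) \<le> C * real k + ln m * (real i0 * real k)"
        by (simp add: algebra_simps)
      then have "ennreal (real k * ln (real k)) \<le> ennreal (C * real k + ln m * (real i0 * real k))"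
        by (rule ennreal_leI)
      also have "\<dots> = ennreal C * of_nat k + ennreal (ln m) * ennreal (real i0 * real k)"
        using C m_gt_1 by (simp add: ennreal_mult ennreal_of_nat_eq_real_of_nat)
      also have "\<dots> \<le> ennreal C * of_nat k + ennreal (ln m) * (\<Sum>i. h i k * of_nat k)"
        using i0_le by (rule add_left_mono)
      finally show ?thesis .
    qed
    then have "(\<integral>\<^sup>+ k. ennreal (real k * ln (real k)) \<partial>measure_pmf q)
        \<le> (\<integral>\<^sup>+ k. ennreal C * of_nat k + ennreal (ln m) * (\<Sum>i. h i k * of_nat k) \<partial>measure_pmf q)"
      by (intro nn_integral_mono) auto
    also have "\<dots> = ennreal C * ennreal m + ennreal (ln m) * (\<integral>\<^sup>+ k. (\<Sum>i. h i k * of_nat k) \<partial>measure_pmf q)"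
      by (subst nn_integral_add, simp, simp, subst (1 2) nn_integral_cmult) (simp_all add: nn_integral_offspring)
    also have "\<dots> < \<top>" using fin by (simp add: ennreal_mult_less_top)
    finally show False unfolding nu_ln_nu by simp
  qed
  define g where "g n = enn2real (trunc_mean q c (ennreal (m ^ n)))" for n
  have g: "trunc_mean q c (ennreal (m ^ n)) = ennreal (g n)" "0 \<le> g n" for n
    unfolding g_def using finite_by[OF trunc_mean_le[of "ennreal (m ^ n)"]] by simp_all
  have g_K: "g n \<le> K" for n
  proof -
    have "ennreal (g n) \<le> (\<integral>\<^sup>+ T. W c T \<partial>GW q)"
      unfolding g(1)[symmetric] trunc_mean_def by (intro nn_integral_mono) (auto simp: indicator_def)
    then show ?thesis using K by simp
  qed
  \<comment> \<open>Cancelling \<open>H (Suc n)\<close> in \<open>spine_1_le\<close> bounds the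
    spine by \<open>m - H (Suc n) / 2\<close>; then \<open>1 - t \<le> exp (- t)\<close> makes the
    gains add up in the exponent.\<close>
  have step: "g n \<le> g (Suc n) * exp (- (H (Suc n) / (2 * m)))" for n
  proof -
    have "ennreal (H (Suc n)) + spine q c 1 (ennreal (m ^ Suc n)) \<le> ennreal m + ennreal (1 / 2) * ennreal (H (Suc n))"
      using spine_1_le[OF \<eta>, of "m ^ Suc n"] m_gt_1 unfolding H(1)[symmetric] h_def by simp
    also have "\<dots> = ennreal m + ennreal (1 / 2 * H (Suc n))"
      by (subst ennreal_mult') simp_all
    also have "\<dots> = ennreal (m + 1 / 2 * H (Suc n))"
      using H(2)[of "Suc n"] m_gt_1 by (subst ennreal_plus) simp_all
    also have "m + 1 / 2 * H (Suc n) = H (Suc n) + (m - H (Suc n) / 2)" by simp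
    also have "ennreal \<dots> = ennreal (H (Suc n)) + ennreal (m - H (Suc n) / 2)"
      using H(2)[of "Suc n"] H_m[of "Suc n"] by (intro ennreal_plus) simp_all
    finally have sp: "spine q c 1 (ennreal (m ^ Suc n)) \<le> ennreal (m - H (Suc n) / 2)"
      by (simp add: ennreal_add_left_cancel_le)
    have "ennreal (m * g n) = ennreal m * trunc_mean q c (ennreal (m ^ n))"
      using m_gt_1 by (simp add: g ennreal_mult')
    also have "\<dots> \<le> trunc_mean q c (ennreal (m ^ Suc n)) * spine q c 1 (ennreal (m ^ Suc n))"
      using trunc_mean_le_spine[of "ennreal (m ^ n)"] m_gt_1 by (simp add: ennreal_mult')
    also have "\<dots> \<le> ennreal (g (Suc n)) * ennreal (m - H (Suc n) / 2)"
      unfolding g by (intro mult_left_mono sp) simp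
    also have "\<dots> = ennreal (g (Suc n) * (m - H (Suc n) / 2))"
      using g(2) by (simp add: ennreal_mult')
    finally have "m * g n \<le> g (Suc n) * (m - H (Suc n) / 2)"
      using g(2)[of "Suc n"] H_m[of "Suc n"] H(2)[of "Suc n"] by (subst (asm) ennreal_le_iff) (auto intro!: mult_nonneg_nonneg)
    then have "g n \<le> g (Suc n) * (1 - H (Suc n) / (2 * m))"
      using m_gt_1 by (simp add: field_simps)
    also have "\<dots> \<le> g (Suc n) * exp (- (H (Suc n) / (2 * m)))"
      using g(2) exp_ge_add_one_self[of "- (H (Suc n) / (2 * m))"] by (intro mult_left_mono) auto
    finally show ?thesis .
  qed
  \<comment> \<open>As \<open>g\<close> is bounded by \<open>K\<close>, a positive
    \<open>g n\<close> would bound the partial sums of the divergent series.\<close>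
  have g_0: "g n = 0" for n
  proof -
    have iter: "g n \<le> g (n + k) * exp (- ((\<Sum>i<k. H (Suc n + i)) / (2 * m)))" for k
    proof (induction k)
      case (Suc k)
      have "g n \<le> g (Suc (n + k)) * exp (- (H (Suc (n + k)) / (2 * m))) * exp (- ((\<Sum>i<k. H (Suc n + i)) / (2 * m)))"
        using Suc step[of "n + k"] by (meson exp_ge_zero mult_right_mono order_trans)
      then show ?case by (simp add: mult.assoc exp_add[symmetric] add_divide_distrib algebra_simps)
    qed simp
    have "\<not> summable (\<lambda>i. H (Suc n + i))"
      using not_summable summable_iff_shift[of H "Suc n"] by (simp add: add.commute)
    moreover have "summable (\<lambda>i. H (Suc n + i))" if pos: "0 < g n"
    proof (rule summableI_nonneg_bounded[OF H(2)])
      fix k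
      have "g n \<le> K * exp (- ((\<Sum>i<k. H (Suc n + i)) / (2 * m)))"
        using iter[of k] g_K[of "n + k"] by (meson exp_ge_zero mult_right_mono order_trans)
      then have "exp ((\<Sum>i<k. H (Suc n + i)) / (2 * m)) \<le> K / g n"
        using pos by (simp add: exp_minus field_simps)
      then have "(\<Sum>i<k. H (Suc n + i)) / (2 * m) \<le> ln (K / g n)"
        by (simp add: ln_ge_iff less_le_trans[OF exp_gt_zero])
      then show "(\<Sum>i<k. H (Suc n + i)) \<le> ln (K / g n) * (2 * m)"
        using m_gt_1 by (simp add: field_simps)
    qed
    ultimately have "g n \<le> 0" by linarith
    then show ?thesis using g(2)[of n] by simp
  qed
  \<comment> \<open>Vanishing truncated means put \<open>W\<close> at 0 or above every power of
    \<open>m\<close>, against its positivity and finiteness.\<close>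
  have "AE T in GW q. W c T * indicator {T. W c T < ennreal (m ^ n)} T = 0" for n
  proof (rule iffD1[OF nn_integral_0_iff_AE])
    show "(\<integral>\<^sup>+ T. W c T * indicator {T. W c T < ennreal (m ^ n)} T \<partial>GW q) = 0"
      using g(1)[of n] g_0[of n] unfolding trunc_mean_def by simp
  qed measurable
  then have "AE T in GW q. \<forall>n. W c T * indicator {T. W c T < ennreal (m ^ n)} T = 0"
    unfolding AE_all_countable by (rule allI)
  then have "AE T in GW q. False"
    using AE_W_pos
  proof eventually_elim
    case (elim T)
    obtain n where "W_inf c T [] < m ^ n" using real_arch_pow[OF m_gt_1] by blast
    then have "W c T < ennreal (m ^ n)" using m_gt_1 by (simp add: W_def ennreal_lessI)
    then show False using elim by (auto dest: spec[of _ n])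
  qed
  then show False using prob_space.AE_False[OF prob_space_GW] by blast
qed

end

section \<open>Mass of the rays that avoid heavy vertices\<close>

text \<open>\<open>kept m c D B j k T\<close> is, up to normalisation, the mass of the rays of \<open>T\<close> for which
  \<open>W < B (j + i)\<close> at level \<open>D j + \<dots> + D (j + i - 1)\<close>, for all \<open>i \<le> k\<close>.\<close>

fun kept :: "real \<Rightarrow> (nat \<Rightarrow> real) \<Rightarrow> (nat \<Rightarrow> nat) \<Rightarrow> (nat \<Rightarrow> ennreal) \<Rightarrow> nat \<Rightarrow> nat \<Rightarrow> tree \<Rightarrow> ennreal" where
  "kept m c D B j 0 T = W c T * indicator {T. W c T < B j} T"
| "kept m c D B j (Suc k) T = ennreal (1 / m ^ D j) * indicator {T. W c T < B j} T
     * (\<Sum>v\<in>level T (D j). kept m c D B (Suc j) k (subtree T v))"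

lemma measurable_kept [measurable]: "kept m c D B j k \<in> borel_measurable tree_space"
proof (induction k arbitrary: j)
  case (Suc k)
  note [measurable] = Suc
  show ?case unfolding kept.simps[abs_def] by measurable
qed (simp only: kept.simps[abs_def], measurable)

context seneta_heyde
begin

text \<open>Restricting thresholds to powers of \<open>m\<close> turns \<open>L\<close> into a
  monotone function of the exponent, as \<open>exists_doubling_sequence\<close> expects. It is
  unbounded by monotone convergence and \<open>nn_integral_W\<close>.\<close>

lemma trunc_mean_powers:
  defines "f \<equiv> \<lambda>n. enn2real (trunc_mean q c (ennreal (m ^ n)))"
  shows "trunc_mean q c (ennreal (m ^ n)) = ennreal (f n)" "mono f" "filterlim f at_top sequentially"
proof -
  have eq: "trunc_mean q c (ennreal (m ^ n)) = ennreal (f n)" for n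
    using trunc_mean_le[of "ennreal (m ^ n)"] unfolding f_def
    by (metis ennreal_enn2real ennreal_less_top le_less_trans)
  then show "trunc_mean q c (ennreal (m ^ n)) = ennreal (f n)" .
  show mono: "mono f"
  proof (rule monoI)
    fix i j :: nat assume "i \<le> j"
    then have "trunc_mean q c (ennreal (m ^ i)) \<le> trunc_mean q c (ennreal (m ^ j))"
      using m_gt_1 by (intro trunc_mean_mono ennreal_leI power_increasing) auto
    then show "f i \<le> f j" unfolding eq by (subst (asm) ennreal_le_iff) (simp_all add: f_def)
  qed
  let ?W = "\<lambda>n T. W c T * indicator {T. W c T < ennreal (m ^ n)} T"
  have "(SUP n. \<integral>\<^sup>+ T. ?W n T \<partial>GW q) = (\<integral>\<^sup>+ T. (SUP n. ?W n T) \<partial>GW q)"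
  proof (rule nn_integral_monotone_convergence_SUP[symmetric])
    have "ennreal (m ^ i) \<le> ennreal (m ^ j)" if "i \<le> j" for i j
      using m_gt_1 that by (intro ennreal_leI power_increasing) auto
    then show "incseq ?W"
      by (intro monoI le_funI mult_left_mono) (auto simp: indicator_def intro: less_le_trans)
  qed measurable
  also have "(\<lambda>T. SUP n. ?W n T) = W c"
  proof
    fix T
    obtain n where "W_inf c T [] < m ^ n" using real_arch_pow[OF m_gt_1] by blast
    then have "W c T = ?W n T" using m_gt_1 by (simp add: W_def ennreal_lessI)
    also have "\<dots> \<le> (SUP n. ?W n T)" by (rule SUP_upper) simp
    finally have "W c T \<le> (SUP n. ?W n T)" .
    moreover have "(SUP n. ?W n T) \<le> W c T" by (intro SUP_least) (auto simp: indicator_def)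
    ultimately show "(SUP n. ?W n T) = W c T" by (rule antisym[rotated])
  qed
  finally have sup: "(SUP n. ennreal (f n)) = \<infinity>"
    using nn_integral_W by (simp add: eq[symmetric] trunc_mean_def)
  show "filterlim f at_top sequentially"
    unfolding filterlim_at_top
  proof
    fix Z :: real
    have "ennreal Z < (SUP n. ennreal (f n))" by (simp add: sup)
    then obtain n where "ennreal Z < ennreal (f n)" by (auto simp: less_SUP_iff)
    then have "Z \<le> f n" by (meson ennreal_leI leD leI less_imp_le)
    then show "eventually (\<lambda>n. Z \<le> f n) sequentially"
      using mono by (auto simp: eventually_sequentially intro!: exI[of _ n] dest: monoD)
  qed
qed

text \<open>The condition \<open>W < B j\<close> at the root is weakened to cousin mass below
  \<open>m ^ D j * B j\<close> at each descendant, an event independent of the descendant's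
  subtree.\<close>

lemma nn_integral_kept_Suc:
  "(\<integral>\<^sup>+ T. kept m c D B j (Suc k) T \<partial>GW q)
    \<le> ennreal (1 / m ^ D j) * spine q c (D j) (ennreal (m ^ D j) * B j) * (\<integral>\<^sup>+ T. kept m c D B (Suc j) k T \<partial>GW q)"
proof -
  let ?K = "kept m c D B (Suc j) k"
  let ?y = "ennreal (m ^ D j) * B j"
  have "(\<integral>\<^sup>+ T. kept m c D B j (Suc k) T \<partial>GW q)
    \<le> (\<integral>\<^sup>+ T. ennreal (1 / m ^ D j) * (\<Sum>v\<in>level T (D j). ?K (subtree T v) * indicator {T. siblings c T v < ?y} T) \<partial>GW q)"
  proof (rule nn_integral_mono_AE, use AE_regular[OF norm_limit] in eventually_elim)
    fix T assume T: "regular c T"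
    show "kept m c D B j (Suc k) T
      \<le> ennreal (1 / m ^ D j) * (\<Sum>v\<in>level T (D j). ?K (subtree T v) * indicator {T. siblings c T v < ?y} T)"
    proof (cases "W c T < B j")
      case True
      then have lt: "ennreal (m ^ D j) * W c T < ?y"
        using m_gt_1 by (intro ennreal_mult_strict_left_mono) auto
      have "siblings c T v < ?y" if v: "v \<in> level T (D j)" for v
      proof -
        have "siblings c T v \<le> ennreal (m ^ D j) * W c T" unfolding W_siblings[OF T v, symmetric] by simp
        then show ?thesis using lt by (rule le_less_trans)
      qed
      then show ?thesis using True by simp
    qed simp
  qed
  also have "\<dots> = ennreal (1 / m ^ D j)
      * (\<integral>\<^sup>+ T. (\<Sum>v\<in>level T (D j). ?K (subtree T v) * indicator {T. siblings c T v < ?y} T) \<partial>GW q)"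
    by (rule nn_integral_cmult) measurable
  also have "\<dots> = ennreal (1 / m ^ D j) * spine q c (D j) ?y * (\<integral>\<^sup>+ T. ?K T \<partial>GW q)"
    by (subst spine_factor) (simp_all add: mult_ac)
  finally show ?thesis .
qed

lemma spine_le_ratio:
  assumes b: "0 < trunc_mean q c (ennreal (m ^ d) * b)" and b_fin: "b < \<top>"
  shows "ennreal (1 / m ^ d) * spine q c d (ennreal (m ^ d) * b)
    \<le> trunc_mean q c (2 * b) / trunc_mean q c (ennreal (m ^ d) * b)"
proof -
  let ?y = "ennreal (m ^ d) * b"
  have "trunc_mean q c ?y \<le> ?y" by (rule trunc_mean_le)
  also have "?y < \<top>" using b_fin by (simp add: ennreal_mult_less_top)
  finally have fin: "trunc_mean q c ?y < \<top>" .
  have one: "ennreal (1 / m ^ d) * ennreal (m ^ d) = 1"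
    using m_gt_1 by (subst ennreal_mult[symmetric]) auto
  have "spine q c d ?y * trunc_mean q c ?y \<le> ennreal (m ^ d) * trunc_mean q c (2 * b)"
    by (rule spine_le_trunc_mean) (simp add: mult_ac)
  then have "ennreal (1 / m ^ d) * (spine q c d ?y * trunc_mean q c ?y)
      \<le> ennreal (1 / m ^ d) * (ennreal (m ^ d) * trunc_mean q c (2 * b))"
    by (rule mult_left_mono) simp
  then have "(ennreal (1 / m ^ d) * spine q c d ?y) * trunc_mean q c ?y \<le> trunc_mean q c (2 * b)"
    using one by (simp add: mult.assoc[symmetric])
  then have "(ennreal (1 / m ^ d) * spine q c d ?y) * trunc_mean q c ?y / trunc_mean q c ?y
      \<le> trunc_mean q c (2 * b) / trunc_mean q c ?y"
    by (rule divide_right_mono_ennreal)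
  then show ?thesis using b fin by (simp add: ennreal_mult_divide_eq)
qed

text \<open>\<open>\<kappa>\<close> absorbs the factor 2 of \<open>spine_le_ratio\<close>. The base
  case leaves the one factor without a denominator,
  \<open>f (\<beta> (j + k) + \<kappa>)\<close>.\<close>

lemma nn_integral_kept_le:
  fixes \<beta> :: "nat \<Rightarrow> nat"
  defines "f \<equiv> \<lambda>n. enn2real (trunc_mean q c (ennreal (m ^ n)))"
  assumes \<kappa>: "2 \<le> m ^ \<kappa>" and pos: "\<And>i. 0 < f (D i + \<beta> i)"
  shows "(\<integral>\<^sup>+ T. kept m c D (\<lambda>i. ennreal (m ^ \<beta> i)) j k T \<partial>GW q)
    \<le> ennreal (f (\<beta> (j + k) + \<kappa>) * (\<Prod>i<k. f (\<beta> (j + i) + \<kappa>) / f (D (j + i) + \<beta> (j + i))))"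
proof (induction k arbitrary: j)
  case 0
  have "(\<integral>\<^sup>+ T. kept m c D (\<lambda>i. ennreal (m ^ \<beta> i)) j 0 T \<partial>GW q) = trunc_mean q c (ennreal (m ^ \<beta> j))"
    by (simp add: trunc_mean_def)
  also have "\<dots> \<le> trunc_mean q c (ennreal (m ^ (\<beta> j + \<kappa>)))"
    using m_gt_1 by (intro trunc_mean_mono ennreal_leI power_increasing) auto
  also have "\<dots> = ennreal (f (\<beta> j + \<kappa>))" unfolding f_def by (rule trunc_mean_powers(1))
  finally show ?case by simp
next
  case (Suc k)
  have f_eq: "trunc_mean q c (ennreal (m ^ n)) = ennreal (f n)" for n
    unfolding f_def by (rule trunc_mean_powers(1))
  have f_nonneg: "0 \<le> f n" for n by (simp add: f_def)
  have y: "ennreal (m ^ D j) * ennreal (m ^ \<beta> j) = ennreal (m ^ (D j + \<beta> j))"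
    using m_gt_1 by (subst ennreal_mult[symmetric]) (auto simp: power_add)
  have "2 * ennreal (m ^ \<beta> j) = ennreal (2 * m ^ \<beta> j)" using m_gt_1 by (simp add: ennreal_mult)
  also have "\<dots> \<le> ennreal (m ^ (\<beta> j + \<kappa>))"
    using \<kappa> m_gt_1 by (intro ennreal_leI) (auto simp: power_add mult.commute[of 2] intro!: mult_left_mono)
  finally have "trunc_mean q c (2 * ennreal (m ^ \<beta> j)) \<le> ennreal (f (\<beta> j + \<kappa>))"
    unfolding f_eq[symmetric] by (rule trunc_mean_mono)
  then have "trunc_mean q c (2 * ennreal (m ^ \<beta> j)) / ennreal (f (D j + \<beta> j))
      \<le> ennreal (f (\<beta> j + \<kappa>)) / ennreal (f (D j + \<beta> j))"
    by (rule divide_right_mono_ennreal)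
  also have "\<dots> = ennreal (f (\<beta> j + \<kappa>) / f (D j + \<beta> j))"
    using f_nonneg pos by (simp add: divide_ennreal)
  finally have ratio: "ennreal (1 / m ^ D j) * spine q c (D j) (ennreal (m ^ D j) * ennreal (m ^ \<beta> j))
      \<le> ennreal (f (\<beta> j + \<kappa>) / f (D j + \<beta> j))"
    using spine_le_ratio[of "D j" "ennreal (m ^ \<beta> j)"] pos[of j] by (simp add: y f_eq)
  have "(\<integral>\<^sup>+ T. kept m c D (\<lambda>i. ennreal (m ^ \<beta> i)) j (Suc k) T \<partial>GW q)
      \<le> ennreal (f (\<beta> j + \<kappa>) / f (D j + \<beta> j))
        * ennreal (f (\<beta> (Suc j + k) + \<kappa>) * (\<Prod>i<k. f (\<beta> (Suc j + i) + \<kappa>) / f (D (Suc j + i) + \<beta> (Suc j + i))))"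
    by (rule order_trans[OF nn_integral_kept_Suc], rule mult_mono[OF ratio Suc]) auto
  also have "\<dots> = ennreal (f (\<beta> (j + Suc k) + \<kappa>) * (\<Prod>i<Suc k. f (\<beta> (j + i) + \<kappa>) / f (D (j + i) + \<beta> (j + i))))"
    using f_nonneg by (subst ennreal_mult'[symmetric]) (auto simp: prod.lessThan_Suc_shift mult_ac simp del: prod.lessThan_Suc)
  finally show ?case .
qed

text \<open>With heavy meaning \<open>W \<ge> m ^ ((1 - 1 / D) n)\<close> at level \<open>n\<close>, the factors of
  \<open>nn_integral_kept_le\<close> are, after an index shift, at most \<open>f (A s) / f ((A + 1) s)\<close> with \<open>A = 4 D - 3\<close>,
  so a sequence of levels \<open>n = 4 D s\<close> from \<open>exists_doubling_sequence\<close> kills the product.\<close>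

lemma AE_kept_vanishes:
  assumes D: "2 \<le> D"
  obtains s :: "nat \<Rightarrow> nat" where "N \<le> s 0" "\<And>j. s j < s (Suc j)"
    "AE T in GW q. (INF k. kept m c (\<lambda>i. 4 * D * (s (Suc i) - s i)) (\<lambda>i. ennreal (m ^ (4 * (D - 1) * s i))) 0 k T) = 0"
proof -
  define f where "f = (\<lambda>n. enn2real (trunc_mean q c (ennreal (m ^ n))))"
  note f = trunc_mean_powers(2,3)[folded f_def]
  have "eventually (\<lambda>n. 0 < f n) sequentially"
    using f(2) unfolding filterlim_at_top_dense by (rule spec)
  then obtain N0 where N0: "\<And>n. N0 \<le> n \<Longrightarrow> 0 < f n"
    unfolding eventually_sequentially by blast
  obtain \<kappa> where "2 < m ^ \<kappa>" using real_arch_pow[OF m_gt_1] by blast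
  then have \<kappa>: "2 \<le> m ^ \<kappa>" by simp
  \<comment> \<open>Thresholds have exponent \<open>4 * (D - 1) * s i\<close>, and one more
    \<open>s i\<close> absorbs \<open>\<kappa>\<close>. On the other side
    \<open>gap i + \<beta> i\<close> equals \<open>4 * D * s (Suc i) - 4 * s i\<close>, of which
    doubling leaves at least \<open>(4 * D - 2) * s (Suc i)\<close>, with
    \<open>4 * D - 2 = A + 1\<close>.\<close>
  define A where "A = 4 * (D - 1) + 1"
  obtain s where s: "N + N0 + \<kappa> \<le> s 0" "\<And>j. 2 * s j \<le> s (Suc j)" "\<And>j. 0 < s j"
    "(\<lambda>k. \<Prod>j<k. f (A * s j) / f ((A + 1) * s j)) \<longlonglongrightarrow> 0"
    by (rule exists_doubling_sequence[OF f(1) _ f(2), of "N + N0 + \<kappa>" A]) (auto simp: A_def N0)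
  have s_mono: "s 0 \<le> s j" for j
  proof (induction j)
    case (Suc j)
    then show ?case using s(2)[of j] by linarith
  qed simp
  define gap where "gap = (\<lambda>i. 4 * D * (s (Suc i) - s i))"
  define \<beta> where "\<beta> = (\<lambda>i. 4 * (D - 1) * s i)"
  have gap_ge: "(A + 1) * s (Suc i) \<le> gap i + \<beta> i" for i
  proof -
    obtain D' where D': "D = Suc D'" using D by (cases D) auto
    obtain r where r: "s (Suc i) = 2 * s i + r" using s(2)[of i] le_Suc_ex by blast
    have "(4 * D' + 2) * (2 * s i + r) \<le> 4 * (D' + 1) * (s i + r) + 4 * D' * s i"
      by (simp add: algebra_simps)
    then show ?thesis by (simp add: A_def gap_def \<beta>_def D' r)
  qed
  have \<beta>_le: "\<beta> i + \<kappa> \<le> A * s i" for i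
    using s(1) s_mono[of i] by (simp add: \<beta>_def A_def)
  have pos: "0 < f (A * s i)" "0 < f ((A + 1) * s i)" "0 < f (gap i + \<beta> i)" for i
  proof -
    have "N0 \<le> A * s j" for j using s(1) s_mono[of j] by (simp add: A_def)
    then have "N0 \<le> A * s i" "N0 \<le> (A + 1) * s i" "N0 \<le> (A + 1) * s (Suc i)"
      by (simp_all add: add_increasing trans_le_add2)
    then show "0 < f (A * s i)" "0 < f ((A + 1) * s i)" "0 < f (gap i + \<beta> i)"
      using order_trans[OF _ gap_ge[of i]] by (blast intro: N0)+
  qed
  have f0: "0 \<le> f n" for n by (simp add: f_def)
  \<comment> \<open>The leading factor moves every numerator on by one index, so that numerator and
    denominator both refer to \<open>s (Suc i)\<close>.\<close>
  have shift: "f (\<beta> k + \<kappa>) * (\<Prod>i<k. f (\<beta> i + \<kappa>) / f (gap i + \<beta> i))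
      \<le> f (\<beta> 0 + \<kappa>) * (\<Prod>i<k. f (A * s (Suc i)) / f ((A + 1) * s (Suc i)))" for k
  proof -
    have "f (\<beta> k + \<kappa>) * (\<Prod>i<k. f (\<beta> i + \<kappa>) / f (gap i + \<beta> i))
        = f (\<beta> 0 + \<kappa>) * (\<Prod>i<k. f (\<beta> (Suc i) + \<kappa>) / f (gap i + \<beta> i))"
      by (induction k) (auto simp: mult_ac)
    also have "\<dots> \<le> f (\<beta> 0 + \<kappa>) * (\<Prod>i<k. f (A * s (Suc i)) / f ((A + 1) * s (Suc i)))"
      using f0 pos monoD[OF f(1) gap_ge] monoD[OF f(1) \<beta>_le]
      by (intro mult_left_mono prod_mono conjI frac_le divide_nonneg_nonneg) auto
    finally show ?thesis .
  qed
  have lim: "(\<lambda>k. f (\<beta> 0 + \<kappa>) * (\<Prod>i<k. f (A * s (Suc i)) / f ((A + 1) * s (Suc i)))) \<longlonglongrightarrow> 0"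
  proof -
    define x where "x i = f (A * s i) / f ((A + 1) * s i)" for i
    have x0: "x 0 \<noteq> 0" using pos(1)[of 0] pos(2)[of 0] by (simp add: x_def)
    have "(\<lambda>k. \<Prod>j<Suc k. x j) \<longlonglongrightarrow> 0" using s(4) unfolding x_def by (rule LIMSEQ_Suc)
    then have "(\<lambda>k. f (\<beta> 0 + \<kappa>) / x 0 * (\<Prod>j<Suc k. x j)) \<longlonglongrightarrow> f (\<beta> 0 + \<kappa>) / x 0 * 0"
      by (intro tendsto_mult tendsto_const)
    then have "(\<lambda>k. f (\<beta> 0 + \<kappa>) * (\<Prod>i<k. x (Suc i))) \<longlonglongrightarrow> 0"
      using x0 by (simp add: prod.lessThan_Suc_shift del: prod.lessThan_Suc)
    then show ?thesis by (simp only: x_def)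
  qed
  let ?K = "kept m c gap (\<lambda>i. ennreal (m ^ \<beta> i)) 0"
  have "(\<integral>\<^sup>+ T. (INF k. ?K k T) \<partial>GW q) \<le> ennreal (f (\<beta> 0 + \<kappa>) * (\<Prod>i<k. f (A * s (Suc i)) / f ((A + 1) * s (Suc i))))" for k
  proof -
    have "(\<integral>\<^sup>+ T. (INF k. ?K k T) \<partial>GW q) \<le> (\<integral>\<^sup>+ T. ?K k T \<partial>GW q)"
      by (intro nn_integral_mono INF_lower) simp
    also have "\<dots> \<le> ennreal (f (\<beta> (0 + k) + \<kappa>) * (\<Prod>i<k. f (\<beta> (0 + i) + \<kappa>) / f (gap (0 + i) + \<beta> (0 + i))))"
      unfolding f_def by (rule nn_integral_kept_le[OF \<kappa>]) (use pos(3) in \<open>simp add: f_def\<close>)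
    also have "\<dots> \<le> ennreal (f (\<beta> 0 + \<kappa>) * (\<Prod>i<k. f (A * s (Suc i)) / f ((A + 1) * s (Suc i))))"
      using shift[of k] by (intro ennreal_leI) simp
    finally show ?thesis .
  qed
  then have "(\<integral>\<^sup>+ T. (INF k. ?K k T) \<partial>GW q) \<le> ennreal 0"
    by (intro LIMSEQ_le_const[OF tendsto_ennrealI[OF lim]]) blast
  then have int0: "(\<integral>\<^sup>+ T. (INF k. ?K k T) \<partial>GW q) = 0" by simp
  have "AE T in GW q. (INF k. ?K k T) = 0"
    by (rule iffD1[OF nn_integral_0_iff_AE int0]) measurable
  moreover have "s j < s (Suc j)" for j using s(2)[of j] s(3)[of j] by linarith
  moreover have "N \<le> s 0" using s(1) by simp
  ultimately show ?thesis using that[of s] by (simp add: gap_def \<beta>_def)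
qed

end

section \<open>The uniform measure\<close>

definition cylinder :: "tree \<Rightarrow> vertex \<Rightarrow> ray set" where
  "cylinder T u = {r \<in> boundary T. r (length u) = u}"

lemma boundary_mem: "r \<in> boundary T \<Longrightarrow> r n \<in> T"
  by (simp add: boundary_def)

lemma cylinder_outside: "u \<notin> T \<Longrightarrow> cylinder T u = {}"
  by (auto simp: cylinder_def dest: boundary_mem[of _ _ "length u"])

lemma cylinder_Nil: "cylinder T [] = boundary T"
  by (auto simp: cylinder_def boundary_def)

lemma cylinder_prefix:
  assumes "prefix u v"
  shows "cylinder T v \<subseteq> cylinder T u"
proof
  fix r assume r: "r \<in> cylinder T v"
  have "r (length u) = take (length u) (r (length v))"
    using r assms by (intro boundary_take[of _ T]) (auto simp: cylinder_def dest: prefix_length_le)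
  then show "r \<in> cylinder T u" using r assms by (auto simp: cylinder_def prefix_def)
qed

lemma cylinder_disjoint:
  assumes "\<not> prefix u v" "\<not> prefix v u"
  shows "cylinder T u \<inter> cylinder T v = {}"
proof -
  have False if r: "r \<in> cylinder T u" "r \<in> cylinder T v" for r
  proof -
    have b: "r \<in> boundary T" "r (length u) = u" "r (length v) = v" using r by (auto simp: cylinder_def)
    show False
    proof (cases "length u \<le> length v")
      case True
      then show False using boundary_take[OF b(1) True] b assms by (metis take_is_prefix)
    next
      case False
      then have "length v \<le> length u" by simp
      then show False using boundary_take[OF b(1)] b assms by (metis take_is_prefix)
    qed
  qed
  then show ?thesis by blast
qed

text \<open>Cylinders are nested or disjoint; the empty set is adjoined for the disjoint
  case.\<close>

lemma Int_stable_cylinders: "Int_stable (insert {} (range (cylinder T)))"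
proof (rule Int_stableI)
  fix a b assume "a \<in> insert {} (range (cylinder T))" "b \<in> insert {} (range (cylinder T))"
  moreover have "cylinder T u \<inter> cylinder T v \<in> insert {} (range (cylinder T))" for u v
    using cylinder_disjoint[of u v T] cylinder_prefix[of u v T] cylinder_prefix[of v u T]
    by (cases "prefix u v"; cases "prefix v u") (auto simp: Int_absorb1 Int_absorb2)
  ultimately show "a \<inter> b \<in> insert {} (range (cylinder T))" by auto
qed

lemma ray_dist_cylinder:
  assumes "r \<in> cylinder T u" "r' \<in> cylinder T u"
  shows "ray_dist r r' \<le> exp (- real (length u))"
proof (cases "r = r'")
  case False
  then have "length u \<le> length (ray_meet r r')"
    using assms length_ray_meet[of r T r' "length u"] by (auto simp: cylinder_def)
  then show ?thesis using False by (simp add: ray_dist_def)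
qed (simp add: ray_dist_def)

lemma space_boundary_borel: "space (boundary_borel T) = boundary T"
  unfolding boundary_borel_def
proof (rule space_measure_of)
  interpret Metric_space "boundary T" ray_dist by (rule Metric_space_boundary)
  show "{U. openin mtopology U} \<subseteq> Pow (boundary T)" using openin_subset[of mtopology] by auto
qed

lemma sets_cylinder' [measurable]: "cylinder T u \<in> sets (boundary_borel T)"
  unfolding cylinder_def by (rule sets_cylinder)

text \<open>Every ball contains a cylinder around its centre, so an open set is the union of the
  cylinders inside it, a countable union since there are countably many vertices.\<close>

lemma sets_boundary_borel:
  "sets (boundary_borel T) = sigma_sets (boundary T) (insert {} (range (cylinder T)))"
proof
  interpret Metric_space "boundary T" ray_dist by (rule Metric_space_boundary)
  have "U \<in> sigma_sets (boundary T) (insert {} (range (cylinder T)))" if U: "openin mtopology U" for U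
  proof -
    have "U = (\<Union>u\<in>{u. cylinder T u \<subseteq> U}. cylinder T u)"
    proof (intro equalityI subsetI)
      fix r assume r: "r \<in> U"
      then have rb: "r \<in> boundary T" using U unfolding openin_mtopology by blast
      obtain e where e: "0 < e" "mball r e \<subseteq> U" using U r unfolding openin_mtopology by blast
      obtain n where n: "exp (- real n) < e"
      proof -
        obtain n where "- ln e < real n" using reals_Archimedean2 by blast
        then have "exp (- real n) < exp (ln e)" by simp
        then show ?thesis using that[of n] e(1) by simp
      qed
      have rc: "r \<in> cylinder T (r n)" using rb by (simp add: cylinder_def boundary_length)
      have "cylinder T (r n) \<subseteq> mball r e"
      proof
        fix r' assume r': "r' \<in> cylinder T (r n)"
        have "ray_dist r r' \<le> exp (- real n)"
          using ray_dist_cylinder[OF rc r'] rb by (simp add: boundary_length)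
        then show "r' \<in> mball r e" using n r' rb by (simp add: in_mball cylinder_def)
      qed
      then show "r \<in> (\<Union>u\<in>{u. cylinder T u \<subseteq> U}. cylinder T u)" using e(2) rc by blast
    qed auto
    moreover have "(\<Union>u\<in>{u. cylinder T u \<subseteq> U}. cylinder T u) \<in> sigma_sets (boundary T) (insert {} (range (cylinder T)))"
      by (rule sigma_sets_UNION) auto
    ultimately show ?thesis by simp
  qed
  then have "{U. openin mtopology U} \<subseteq> sigma_sets (boundary T) (insert {} (range (cylinder T)))"
    by blast
  then have "sigma_sets (boundary T) {U. openin mtopology U} \<subseteq> sigma_sets (boundary T) (insert {} (range (cylinder T)))"
    by (rule sigma_sets_mono)
  moreover have "{U. openin mtopology U} \<subseteq> Pow (boundary T)"
    using openin_subset[of mtopology] by auto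
  ultimately show "sets (boundary_borel T) \<subseteq> sigma_sets (boundary T) (insert {} (range (cylinder T)))"
    by (simp add: boundary_borel_def)
  have "insert {} (range (cylinder T)) \<subseteq> sets (boundary_borel T)" by auto
  from sets.sigma_sets_subset[OF this] show "sigma_sets (boundary T) (insert {} (range (cylinder T))) \<subseteq> sets (boundary_borel T)"
    by (simp add: space_boundary_borel)
qed

lemma boundary_measure_eqI:
  assumes \<mu>: "sets \<mu> = sets (boundary_borel T)" "prob_space \<mu>"
    and \<nu>: "sets \<nu> = sets (boundary_borel T)"
    and eq: "\<And>u. u \<in> T \<Longrightarrow> emeasure \<mu> (cylinder T u) = emeasure \<nu> (cylinder T u)"
  shows "\<mu> = \<nu>"
proof (rule measure_eqI_generator_eq[where E = "insert {} (range (cylinder T))" and \<Omega> = "boundary T" and A = "\<lambda>_. boundary T"])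
  interpret prob_space \<mu> by fact
  show "Int_stable (insert {} (range (cylinder T)))" by (rule Int_stable_cylinders)
  show "insert {} (range (cylinder T)) \<subseteq> Pow (boundary T)" by (auto simp: cylinder_def)
  fix X assume "X \<in> insert {} (range (cylinder T))"
  then show "emeasure \<mu> X = emeasure \<nu> X" using eq cylinder_outside by fastforce
next
  interpret prob_space \<mu> by fact
  show "emeasure \<mu> (boundary T) \<noteq> \<infinity>" for i :: nat by simp
  show "range (\<lambda>_. boundary T) \<subseteq> insert {} (range (cylinder T))" using cylinder_Nil by blast
qed (use \<mu> \<nu> in \<open>auto simp: sets_boundary_borel\<close>)

section \<open>The uniform measure as the law of a random descent\<close>

context
  fixes m :: real and c :: "nat \<Rightarrow> real" and T :: tree
  assumes T: "regular c T" and c: "(\<lambda>n. c (Suc n) / c n) \<longlonglongrightarrow> m" and m: "1 < m"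
begin

lemma W_pos: "u \<in> T \<Longrightarrow> 0 < W_inf c T u"
  using regular_limit(2)[OF T] .

lemma sum_W_children:
  assumes "u \<in> T"
  shows "(\<Sum>k | u @ [k] \<in> T. W_inf c T (u @ [k])) = m * W_inf c T u"
  using sum_W_inf_desc[OF T assms c m, of 1] unfolding desc_1
  by (simp add: sum.reindex inj_on_def)

text \<open>At a leaf the sum over the children would be empty, against
  \<open>m * W_inf c T u > 0\<close>. Child 0 is thus always available as a default.\<close>

lemma first_child: "u \<in> T \<Longrightarrow> u @ [0] \<in> T"
proof -
  assume u: "u \<in> T"
  then obtain n where n: "{k. u @ [k] \<in> T} = {..<n}"
    using regular_rooted[OF T] by (auto simp: rooted_tree_def)
  have "n \<noteq> 0"
  proof
    assume "n = 0"
    then have "m * W_inf c T u = 0" using sum_W_children[OF u] unfolding n by simp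
    then show False using W_pos[OF u] m by simp
  qed
  then show ?thesis using n by auto
qed

text \<open>Transition law of a descent that picks each child with probability proportional to its
  \<open>W_inf\<close>. Off the tree a point mass fills in, so that the product can run over all
  vertices.\<close>

definition child_pmf :: "vertex \<Rightarrow> nat pmf" where
  "child_pmf u = embed_pmf (\<lambda>k. if u \<in> T then
      if u @ [k] \<in> T then W_inf c T (u @ [k]) / (m * W_inf c T u) else 0
    else indicator {0} k)"

lemma pmf_child_pmf:
  assumes "u \<in> T"
  shows "pmf (child_pmf u) k = (if u @ [k] \<in> T then W_inf c T (u @ [k]) / (m * W_inf c T u) else 0)"
proof -
  let ?f = "\<lambda>k. if u @ [k] \<in> T then W_inf c T (u @ [k]) / (m * W_inf c T u) else 0"
  have nonneg: "0 \<le> ?f k" for k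
    using W_pos[OF assms] W_pos[of "u @ [k]"] m by (auto intro!: divide_nonneg_pos mult_pos_pos)
  have "(\<integral>\<^sup>+ k. ennreal (?f k) \<partial>count_space UNIV) = (\<Sum>k | u @ [k] \<in> T. ennreal (?f k))"
    using finite_children[OF regular_rooted[OF T]] by (intro nn_integral_count_space') auto
  also have "\<dots> = ennreal (\<Sum>k | u @ [k] \<in> T. ?f k)"
    by (rule sum_ennreal) (rule nonneg)
  also have "(\<Sum>k | u @ [k] \<in> T. ?f k) = (\<Sum>k | u @ [k] \<in> T. W_inf c T (u @ [k])) / (m * W_inf c T u)"
    by (simp add: sum_divide_distrib)
  also have "\<dots> = 1" using W_pos[OF assms] m by (simp add: sum_W_children[OF assms])
  finally show ?thesis
    using assms nonneg unfolding child_pmf_def by (subst pmf_embed_pmf) auto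
qed

lemma set_child_pmf: "u \<in> T \<Longrightarrow> k \<in> set_pmf (child_pmf u) \<Longrightarrow> u @ [k] \<in> T"
  by (auto simp: set_pmf_iff pmf_child_pmf split: if_splits)

text \<open>Falling back to child 0 makes \<open>follow\<close> a ray of \<open>T\<close> for every
  choice function, not merely for almost every one.\<close>

definition child :: "(vertex \<Rightarrow> nat) \<Rightarrow> vertex \<Rightarrow> nat" where
  "child \<omega> u = (if u @ [\<omega> u] \<in> T then \<omega> u else 0)"

primrec follow :: "(vertex \<Rightarrow> nat) \<Rightarrow> ray" where
  "follow \<omega> 0 = []"
| "follow \<omega> (Suc n) = follow \<omega> n @ [child \<omega> (follow \<omega> n)]"

lemma length_follow: "length (follow \<omega> n) = n"
  by (induction n) auto

lemma follow_boundary: "follow \<omega> \<in> boundary T"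
proof -
  have "follow \<omega> n \<in> T" for n
    by (induction n) (auto simp: regular_root[OF T] child_def first_child)
  moreover have "inj (follow \<omega>)" by (metis injI length_follow)
  ultimately show ?thesis by (auto simp: boundary_def adjacent_def)
qed

lemma follow_eq_iff: "follow \<omega> (length v) = v \<longleftrightarrow> (\<forall>i<length v. child \<omega> (take i v) = v ! i)"
proof (induction v rule: rev_induct)
  case (snoc x v)
  have "follow \<omega> (length (v @ [x])) = v @ [x] \<longleftrightarrow> follow \<omega> (length v) = v \<and> child \<omega> v = x"
    by auto
  also have "\<dots> \<longleftrightarrow> (\<forall>i<length (v @ [x]). child \<omega> (take i (v @ [x])) = (v @ [x]) ! i)"
    unfolding snoc by (auto simp: nth_append less_Suc_eq)
  finally show ?case .
qed simp

abbreviation "child_space \<equiv> PiM UNIV (\<lambda>u. measure_pmf (child_pmf u))"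

text \<open>The choices along \<open>v\<close> are made at distinct vertices, hence independently,
  and the product of the ratios telescopes.\<close>

lemma prob_follow:
  shows "{\<omega> \<in> space child_space. follow \<omega> (length v) = v} \<in> sets child_space"
    and "v \<in> T \<Longrightarrow> emeasure child_space {\<omega> \<in> space child_space. follow \<omega> (length v) = v}
      = ennreal (W_inf c T v / (m ^ length v * W_inf c T []))"
proof -
  interpret P: product_prob_space "\<lambda>u. measure_pmf (child_pmf u)" "UNIV :: vertex set" by unfold_locales
  define J where "J = (\<lambda>i. take i v) ` {..<length v}"
  define X where "X u = {k. (if u @ [k] \<in> T then k else 0) = v ! length u}" for u
  have eq: "{\<omega> \<in> space child_space. follow \<omega> (length v) = v} = {\<omega> \<in> space child_space. \<forall>u\<in>J. \<omega> u \<in> X u}"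
    unfolding follow_eq_iff J_def X_def child_def by (auto simp: min_def)
  have J: "finite J" by (simp add: J_def)
  show "{\<omega> \<in> space child_space. follow \<omega> (length v) = v} \<in> sets child_space"
    unfolding eq using J by measurable
  assume v: "v \<in> T"
  have take_T: "take i v \<in> T" for i
    using rooted_tree_prefix[OF regular_rooted[OF T] v take_is_prefix] .
  have inj: "inj_on (\<lambda>i. take i v) {..<length v}"
    by (rule inj_onI) (metis length_take lessThan_iff min.absorb4)
  have X: "emeasure (measure_pmf (child_pmf (take i v))) (X (take i v))
      = ennreal (W_inf c T (take (Suc i) v) / (m * W_inf c T (take i v)))" if i: "i < length v" for i
  proof -
    have snoc: "take i v @ [v ! i] = take (Suc i) v" using i by (simp add: take_Suc_conv_app_nth)
    have "emeasure (measure_pmf (child_pmf (take i v))) (X (take i v))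
        = emeasure (measure_pmf (child_pmf (take i v))) {v ! i}"
    proof (rule emeasure_eq_AE)
      \<comment> \<open>Because of the default, \<open>X\<close> may also contain indices leading
        outside the tree; these have probability 0.\<close>
      show "AE k in measure_pmf (child_pmf (take i v)). k \<in> X (take i v) \<longleftrightarrow> k \<in> {v ! i}"
        using i by (auto simp: AE_measure_pmf_iff X_def min_def dest: set_child_pmf[OF take_T])
    qed auto
    also have "\<dots> = ennreal (pmf (child_pmf (take i v)) (v ! i))" by (simp add: emeasure_pmf_single)
    finally show ?thesis using take_T[of "Suc i"] by (simp add: pmf_child_pmf[OF take_T] snoc)
  qed
  have "emeasure child_space {\<omega> \<in> space child_space. follow \<omega> (length v) = v}
      = (\<Prod>u\<in>J. emeasure (measure_pmf (child_pmf u)) (X u))"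
    unfolding eq using J by (intro P.emeasure_PiM_Collect) auto
  also have "\<dots> = (\<Prod>i<length v. emeasure (measure_pmf (child_pmf (take i v))) (X (take i v)))"
    unfolding J_def by (simp add: prod.reindex[OF inj])
  also have "\<dots> = (\<Prod>i<length v. ennreal (W_inf c T (take (Suc i) v) / (m * W_inf c T (take i v))))"
    by (intro prod.cong) (auto simp: X)
  also have "\<dots> = ennreal (\<Prod>i<length v. W_inf c T (take (Suc i) v) / (m * W_inf c T (take i v)))"
    using W_pos[OF take_T] m by (intro prod_ennreal) (simp add: less_imp_le)
  also have "(\<Prod>i<n. W_inf c T (take (Suc i) v) / (m * W_inf c T (take i v))) = W_inf c T (take n v) / (m ^ n * W_inf c T [])" for n
  proof (induction n)
    case 0
    show ?case using W_pos[OF regular_root[OF T]] by simp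
  next
    case (Suc n)
    then show ?case using W_pos[OF take_T[of n]] by simp
  qed
  finally show "emeasure child_space {\<omega> \<in> space child_space. follow \<omega> (length v) = v}
      = ennreal (W_inf c T v / (m ^ length v * W_inf c T []))"
    by simp
qed

lemma measurable_follow: "follow \<in> measurable child_space (boundary_borel T)"
proof (rule measurableI)
  show "follow \<omega> \<in> space (boundary_borel T)" for \<omega> by (simp add: space_boundary_borel follow_boundary)
  fix A assume "A \<in> sets (boundary_borel T)"
  then have "A \<in> sigma_sets (boundary T) (insert {} (range (cylinder T)))" by (simp add: sets_boundary_borel)
  then show "follow -` A \<inter> space child_space \<in> sets child_space"
  proof induction
    case (Basic A)
    have "follow -` cylinder T u \<inter> space child_space = {\<omega> \<in> space child_space. follow \<omega> (length u) = u}" for u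
      by (auto simp: cylinder_def follow_boundary)
    then show ?case using Basic prob_follow(1) by auto
  next
    case (Compl A)
    have "follow -` (boundary T - A) \<inter> space child_space = space child_space - (follow -` A \<inter> space child_space)"
      by (auto simp: follow_boundary)
    then show ?case using Compl by auto
  next
    case (Union A)
    have "follow -` (\<Union>i. A i) \<inter> space child_space = (\<Union>i. follow -` A i \<inter> space child_space)"
      by blast
    also have "\<dots> \<in> sets child_space" using Union.IH by (intro sets.countable_UN) blast
    finally show ?case .
  qed simp
qed

lemma is_uniform_measure_iff:
  "is_uniform_measure m c T \<mu> \<longleftrightarrow> sets \<mu> = sets (boundary_borel T) \<and> prob_space \<mu> \<and>
    (\<forall>u\<in>T. emeasure \<mu> (cylinder T u) = ennreal (W_inf c T u / (m ^ length u * W_inf c T [])))"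
proof -
  have "m powi (- int n) * x / y = x / (m ^ n * y)" for n x y
    by (simp add: power_int_minus field_simps)
  then show ?thesis unfolding is_uniform_measure_def cylinder_def by auto
qed

lemma uniform_measure_exists: "\<exists>\<mu>. is_uniform_measure m c T \<mu>"
proof -
  interpret P: product_prob_space "\<lambda>u. measure_pmf (child_pmf u)" "UNIV :: vertex set" by unfold_locales
  let ?\<mu> = "distr child_space (boundary_borel T) follow"
  have "emeasure ?\<mu> (cylinder T u) = ennreal (W_inf c T u / (m ^ length u * W_inf c T []))" if "u \<in> T" for u
  proof -
    have "follow -` cylinder T u \<inter> space child_space = {\<omega> \<in> space child_space. follow \<omega> (length u) = u}"
      by (auto simp: cylinder_def follow_boundary)
    then show ?thesis using prob_follow(2)[OF that] by (simp add: emeasure_distr measurable_follow)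
  qed
  then show ?thesis
    unfolding is_uniform_measure_iff by (auto intro!: exI[of _ ?\<mu>] P.prob_space_distr measurable_follow)
qed

lemma is_uniform_measure_UNIF: "is_uniform_measure m c T (UNIF m c T)"
proof -
  obtain \<mu> where \<mu>: "is_uniform_measure m c T \<mu>" using uniform_measure_exists by blast
  have "\<nu> = \<mu>" if "is_uniform_measure m c T \<nu>" for \<nu>
    using \<mu> that unfolding is_uniform_measure_iff by (intro boundary_measure_eqI[of _ T]) auto
  from theI[where P = "is_uniform_measure m c T", OF \<mu> this] show ?thesis
    unfolding UNIF_def .
qed

lemma sets_UNIF [measurable_cong]: "sets (UNIF m c T) = sets (boundary_borel T)"
  and prob_space_UNIF: "prob_space (UNIF m c T)"
  and emeasure_UNIF: "u \<in> T \<Longrightarrow> emeasure (UNIF m c T) (cylinder T u) = ennreal (W_inf c T u / (m ^ length u * W_inf c T []))"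
  using is_uniform_measure_UNIF by (auto simp: is_uniform_measure_iff)

lemma space_UNIF: "space (UNIF m c T) = boundary T"
  using sets_eq_imp_space_eq[OF sets_UNIF] by (simp add: space_boundary_borel)

end

section \<open>Heavy vertices\<close>

text \<open>\<open>heavy m c D T u\<close> says that \<open>W u \<ge> m ^ ((1 - 1 / D) n)\<close> at level \<open>n\<close>, that is, that the
  uniform mass of \<open>u\<close> is at least \<open>m ^ (- n / D)\<close> up to a constant.\<close>

definition heavy :: "real \<Rightarrow> (nat \<Rightarrow> real) \<Rightarrow> nat \<Rightarrow> tree \<Rightarrow> vertex \<Rightarrow> bool" where
  "heavy m c D T u \<longleftrightarrow> m ^ ((D - 1) * length u) \<le> W_inf c T u ^ D"

text \<open>One set serves every \<open>D\<close>: the dimension of a measure is an attained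
  minimum, so a single set of full mass must have dimension exactly 0. Countable quantifiers keep it
  Borel.\<close>

definition heavy_rays :: "real \<Rightarrow> (nat \<Rightarrow> real) \<Rightarrow> tree \<Rightarrow> ray set" where
  "heavy_rays m c T = {r \<in> boundary T. \<forall>D\<ge>2. \<forall>N. \<exists>n\<ge>N. heavy m c D T (r n)}"

lemma sets_boundary_at: "{r \<in> boundary T. Q (r n)} \<in> sets (boundary_borel T)"
proof -
  have "{r \<in> boundary T. Q (r n)} = (\<Union>u\<in>{u. Q u}. {r \<in> boundary T. r n = u})" by auto
  also have "\<dots> \<in> sets (boundary_borel T)"
    using sets_cylinder by (intro sets.countable_UN'') auto
  finally show ?thesis .
qed

lemma sets_space_at: "{r \<in> space (boundary_borel T). Q (r n)} \<in> sets (boundary_borel T)"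
  unfolding space_boundary_borel by (rule sets_boundary_at)

lemma sets_heavy_rays: "heavy_rays m c T \<in> sets (boundary_borel T)"
proof -
  have "{r \<in> space (boundary_borel T). \<forall>D. 2 \<le> D \<longrightarrow> (\<forall>N. \<exists>n. N \<le> n \<and> heavy m c D T (r n))} \<in> sets (boundary_borel T)"
    by (intro sets.sets_Collect_countable_All sets.sets_Collect_imp sets.sets_Collect_const
        sets.sets_Collect_countable_Ex sets.sets_Collect_conj) (rule sets_space_at)
  then show ?thesis by (simp only: heavy_rays_def space_boundary_borel)
qed

section \<open>Mass of the rays that stay light on a sequence of levels\<close>

definition light_rays :: "tree \<Rightarrow> (nat \<Rightarrow> real) \<Rightarrow> (nat \<Rightarrow> nat) \<Rightarrow> (nat \<Rightarrow> ennreal) \<Rightarrow> nat \<Rightarrow> nat \<Rightarrow> vertex \<Rightarrow> ray set" where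
  "light_rays T c l B j k v = {r \<in> boundary T. r (l j) = v \<and> (\<forall>i\<in>{j..j + k}. ennreal (W_inf c T (r (l i))) < B i)}"

lemma sets_light_rays: "light_rays T c l B j k v \<in> sets (boundary_borel T)"
proof -
  have "{r \<in> space (boundary_borel T). r (l j) = v \<and> (\<forall>i\<in>{j..j + k}. ennreal (W_inf c T (r (l i))) < B i)}
      \<in> sets (boundary_borel T)"
    by (intro sets.sets_Collect_conj sets.sets_Collect_finite_All finite_atLeastAtMost) (rule sets_space_at)+
  then show ?thesis by (simp add: light_rays_def space_boundary_borel)
qed

text \<open>Induction on the number of steps, splitting rays by their vertex at the next level. The
  factor \<open>m ^ l j * W_inf c T []\<close> undoes the normalisation: a cylinder at level
  \<open>l j\<close> then weighs \<open>W_inf\<close> of its vertex.\<close>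

lemma emeasure_light_rays_le:
  assumes T: "regular c T" and c: "(\<lambda>n. c (Suc n) / c n) \<longlonglongrightarrow> m" and m: "1 < m"
    and l: "\<And>i. l i \<le> l (Suc i)" and v: "v \<in> T" "length v = l j"
  shows "ennreal (m ^ l j * W_inf c T []) * emeasure (UNIF m c T) (light_rays T c l B j k v)
    \<le> kept m c (\<lambda>i. l (Suc i) - l i) B j k (subtree T v)"
  using v
proof (induction k arbitrary: j v)
  case (0 j v)
  have W0: "0 < W_inf c T []" using regular_limit(2)[OF T regular_root[OF T]] .
  have W: "W c (subtree T v) = ennreal (W_inf c T v)" using 0 by (simp add: W_def W_inf_subtree)
  show ?case
  proof (cases "ennreal (W_inf c T v) < B j")
    case False
    then have "light_rays T c l B j 0 v = {}" by (auto simp: light_rays_def)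
    then show ?thesis by simp
  next
    case True
    have "light_rays T c l B j 0 v \<subseteq> cylinder T v"
      using 0 by (auto simp: light_rays_def cylinder_def)
    then have "emeasure (UNIF m c T) (light_rays T c l B j 0 v) \<le> emeasure (UNIF m c T) (cylinder T v)"
      by (intro emeasure_mono) (simp_all add: sets_UNIF[OF T c m])
    also have "\<dots> = ennreal (W_inf c T v / (m ^ l j * W_inf c T []))"
      using emeasure_UNIF[OF T c m 0(1)] 0(2) by simp
    finally have "ennreal (m ^ l j * W_inf c T []) * emeasure (UNIF m c T) (light_rays T c l B j 0 v)
        \<le> ennreal (m ^ l j * W_inf c T []) * ennreal (W_inf c T v / (m ^ l j * W_inf c T []))"
      by (rule mult_left_mono) simp
    also have "\<dots> = ennreal (W_inf c T v)"
      using W0 m by (subst ennreal_mult'[symmetric]) auto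
    finally show ?thesis using True by (simp add: W)
  qed
next
  case (Suc k j v)
  define d where "d = l (Suc j) - l j"
  have W: "W c (subtree T v) = ennreal (W_inf c T v)" using Suc by (simp add: W_def W_inf_subtree)
  have W0: "0 < W_inf c T []" using regular_limit(2)[OF T regular_root[OF T]] .
  have rt: "rooted_tree T" using T by (rule regular_rooted)
  show ?case
  proof (cases "ennreal (W_inf c T v) < B j")
    case False
    then have "light_rays T c l B j (Suc k) v = {}" by (auto simp: light_rays_def)
    then show ?thesis by simp
  next
    case True
    have len: "length v + d = l (Suc j)" using l[of j] Suc.prems(2) by (simp add: d_def)
    have scale: "ennreal (m ^ l j * W_inf c T []) = ennreal (1 / m ^ d) * ennreal (m ^ l (Suc j) * W_inf c T [])"
    proof -
      have "m ^ l (Suc j) = m ^ d * m ^ l j" using l[of j] by (simp add: d_def flip: power_add)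
      then show ?thesis using m W0 by (subst ennreal_mult'[symmetric]) auto
    qed
    have sub: "light_rays T c l B j (Suc k) v \<subseteq> (\<Union>u\<in>desc T v d. light_rays T c l B (Suc j) k u)"
    proof
      fix r assume r: "r \<in> light_rays T c l B j (Suc k) v"
      then have rb: "r \<in> boundary T" "r (l j) = v" by (auto simp: light_rays_def)
      have "v = take (l j) (r (l (Suc j)))" unfolding rb(2)[symmetric] by (rule boundary_take[OF rb(1) l])
      then have "prefix v (r (l (Suc j)))" by (metis take_is_prefix)
      then have "r (l (Suc j)) \<in> desc T v d"
        using boundary_mem[OF rb(1)] len boundary_length[OF rb(1)] by (simp add: desc_def)
      moreover have "r \<in> light_rays T c l B (Suc j) k (r (l (Suc j)))"
        using r by (auto simp: light_rays_def)
      ultimately show "r \<in> (\<Union>u\<in>desc T v d. light_rays T c l B (Suc j) k u)" by blast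
    qed
    have "emeasure (UNIF m c T) (light_rays T c l B j (Suc k) v)
        \<le> emeasure (UNIF m c T) (\<Union>u\<in>desc T v d. light_rays T c l B (Suc j) k u)"
      using finite_desc[OF rt]
      by (intro emeasure_mono[OF sub]) (simp add: sets_UNIF[OF T c m] sets_light_rays sets.finite_UN)
    also have "\<dots> \<le> (\<Sum>u\<in>desc T v d. emeasure (UNIF m c T) (light_rays T c l B (Suc j) k u))"
      by (rule emeasure_subadditive_finite) (auto simp: finite_desc[OF rt] sets_UNIF[OF T c m] sets_light_rays)
    finally have "ennreal (m ^ l j * W_inf c T []) * emeasure (UNIF m c T) (light_rays T c l B j (Suc k) v)
      \<le> ennreal (m ^ l j * W_inf c T []) * (\<Sum>u\<in>desc T v d. emeasure (UNIF m c T) (light_rays T c l B (Suc j) k u))"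
      by (rule mult_left_mono) simp
    also have "ennreal (m ^ l j * W_inf c T []) * (\<Sum>u\<in>desc T v d. emeasure (UNIF m c T) (light_rays T c l B (Suc j) k u))
        = ennreal (1 / m ^ d) * (\<Sum>u\<in>desc T v d. ennreal (m ^ l (Suc j) * W_inf c T []) * emeasure (UNIF m c T) (light_rays T c l B (Suc j) k u))"
      unfolding scale by (simp add: mult.assoc sum_distrib_left)
    also have "\<dots> \<le> ennreal (1 / m ^ d) * (\<Sum>u\<in>desc T v d. kept m c (\<lambda>i. l (Suc i) - l i) B (Suc j) k (subtree T u))"
      using len by (intro mult_left_mono sum_mono Suc.IH) (auto simp: desc_def)
    also have "(\<Sum>u\<in>desc T v d. kept m c (\<lambda>i. l (Suc i) - l i) B (Suc j) k (subtree T u))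
        = (\<Sum>x\<in>level (subtree T v) d. kept m c (\<lambda>i. l (Suc i) - l i) B (Suc j) k (subtree (subtree T v) x))"
      unfolding sum_desc_subtree[OF Suc.prems(1)]
      by (intro sum.cong refl) (simp add: mem_level subtree_subtree[OF Suc.prems(1)])
    also have "ennreal (1 / m ^ d) * \<dots> = kept m c (\<lambda>i. l (Suc i) - l i) B j (Suc k) (subtree T v)"
      using True by (simp add: W d_def)
    finally show ?thesis .
  qed
qed

text \<open>Rays are split at level \<open>l 0 \<ge> N\<close>, hence the demand on subtrees at
  vertices of \<open>T\<close>. A ray without heavy vertices from level \<open>N\<close> on lies in
  a null intersection of \<open>light_rays\<close> over \<open>k\<close>; the pairs
  \<open>D\<close>, \<open>N\<close> are countable.\<close>

lemma emeasure_heavy_rays: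
  assumes T: "regular c T" and c: "(\<lambda>n. c (Suc n) / c n) \<longlonglongrightarrow> m" and m: "1 < m"
    and vanish: "\<And>D N. 2 \<le> D \<Longrightarrow> \<exists>s :: nat \<Rightarrow> nat. N \<le> s 0 \<and> (\<forall>j. s j < s (Suc j)) \<and>
      (\<forall>v\<in>T. (INF k. kept m c (\<lambda>i. 4 * D * (s (Suc i) - s i)) (\<lambda>i. ennreal (m ^ (4 * (D - 1) * s i))) 0 k (subtree T v)) = 0)"
  shows "emeasure (UNIF m c T) (heavy_rays m c T) = 1"
proof -
  interpret prob_space "UNIF m c T" by (rule prob_space_UNIF[OF T c m])
  have W0: "0 < W_inf c T []" using regular_limit(2)[OF T regular_root[OF T]] .
  have rt: "rooted_tree T" using T by (rule regular_rooted)
  have "AE r in UNIF m c T. \<exists>n\<ge>N. heavy m c D T (r n)" if D: "2 \<le> D" for D N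
  proof -
    obtain s where s: "N \<le> s 0" "\<And>j. s j < s (Suc j)"
      and inf: "\<And>v. v \<in> T \<Longrightarrow> (INF k. kept m c (\<lambda>i. 4 * D * (s (Suc i) - s i)) (\<lambda>i. ennreal (m ^ (4 * (D - 1) * s i))) 0 k (subtree T v)) = 0"
      using vanish[OF D, of N] by blast
    \<comment> \<open>At level \<open>4 * D * s i\<close> the threshold
      \<open>m ^ (4 * (D - 1) * s i)\<close> is exactly heaviness: its \<open>D\<close>-th power is
      \<open>m ^ ((D - 1) * l i)\<close>.\<close>
    define l where "l i = 4 * D * s i" for i
    define B where "B i = ennreal (m ^ (4 * (D - 1) * s i))" for i
    have l_mono: "l i \<le> l (Suc i)" for i using s(2)[of i] by (simp add: l_def)
    have gap: "(\<lambda>i. l (Suc i) - l i) = (\<lambda>i. 4 * D * (s (Suc i) - s i))"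
      by (auto simp: l_def diff_mult_distrib2)
    have s_mono: "s 0 \<le> s i" for i
    proof (induction i)
      case (Suc i)
      then show ?case using s(2)[of i] by linarith
    qed simp
    have null: "emeasure (UNIF m c T) (\<Inter>k. light_rays T c l B 0 k v) = 0" if v: "v \<in> level T (l 0)" for v
    proof -
      let ?x = "emeasure (UNIF m c T) (\<Inter>k. light_rays T c l B 0 k v)"
      have "ennreal (m ^ l 0 * W_inf c T []) * ?x \<le> (INF k. kept m c (\<lambda>i. l (Suc i) - l i) B 0 k (subtree T v))"
      proof (rule INF_greatest)
        fix k
        have "?x \<le> emeasure (UNIF m c T) (light_rays T c l B 0 k v)"
          by (intro emeasure_mono) (auto simp: sets_UNIF[OF T c m] sets_light_rays)
        then have "ennreal (m ^ l 0 * W_inf c T []) * ?x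
            \<le> ennreal (m ^ l 0 * W_inf c T []) * emeasure (UNIF m c T) (light_rays T c l B 0 k v)"
          by (rule mult_left_mono) simp
        also have "\<dots> \<le> kept m c (\<lambda>i. l (Suc i) - l i) B 0 k (subtree T v)"
          using v by (intro emeasure_light_rays_le[where l = l, OF T c m l_mono]) (auto simp: mem_level)
        finally show "ennreal (m ^ l 0 * W_inf c T []) * ?x \<le> kept m c (\<lambda>i. l (Suc i) - l i) B 0 k (subtree T v)" .
      qed
      also have "\<dots> = 0" unfolding gap B_def using inf v by (simp add: mem_level)
      finally have "ennreal (m ^ l 0 * W_inf c T []) * ?x = 0" by simp
      moreover have "0 < m ^ l 0 * W_inf c T []" using W0 m by simp
      ultimately show ?thesis by (simp add: ennreal_eq_0_iff)
    qed
    have N_sets: "(\<Inter>k. light_rays T c l B 0 k v) \<in> sets (UNIF m c T)" for v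
      by (intro sets.countable_INT) (auto simp: sets_UNIF[OF T c m] sets_light_rays)
    have "AE r in UNIF m c T. \<forall>v\<in>level T (l 0). r \<notin> (\<Inter>k. light_rays T c l B 0 k v)"
    proof (rule AE_finite_allI[OF finite_desc[OF rt]])
      fix v assume v: "v \<in> level T (l 0)"
      have "(\<Inter>k. light_rays T c l B 0 k v) \<in> null_sets (UNIF m c T)"
        using null[OF v] N_sets by (rule null_setsI)
      then show "AE r in UNIF m c T. r \<notin> (\<Inter>k. light_rays T c l B 0 k v)" by (rule AE_not_in)
    qed
    with AE_space show ?thesis
    proof eventually_elim
      case (elim r)
      then have r: "r \<in> boundary T" by (simp add: space_UNIF[OF T c m])
      then have "r (l 0) \<in> level T (l 0)" by (simp add: mem_level boundary_length boundary_mem)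
      with elim(2) obtain k where "r \<notin> light_rays T c l B 0 k (r (l 0))" by blast
      then obtain i where "\<not> ennreal (W_inf c T (r (l i))) < B i" using r by (auto simp: light_rays_def)
      then have "B i \<le> ennreal (W_inf c T (r (l i)))" by (rule leI)
      then have le: "m ^ (4 * (D - 1) * s i) \<le> W_inf c T (r (l i))"
        using regular_limit(2)[OF T boundary_mem[OF r]] unfolding B_def
        by (subst (asm) ennreal_le_iff) (auto simp: less_imp_le)
      have "m ^ ((D - 1) * length (r (l i))) = (m ^ (4 * (D - 1) * s i)) ^ D"
        by (simp add: boundary_length[OF r] l_def mult_ac flip: power_mult)
      also have "\<dots> \<le> W_inf c T (r (l i)) ^ D"
        using le m by (intro power_mono) auto
      finally have "heavy m c D T (r (l i))" by (simp add: heavy_def)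
      moreover have "N \<le> l i"
      proof -
        have "1 * N \<le> 4 * D * s i" using s(1) s_mono[of i] D by (intro mult_le_mono) auto
        then show ?thesis by (simp add: l_def)
      qed
      ultimately show ?case by blast
    qed
  qed
  then have "AE r in UNIF m c T. \<forall>D N. 2 \<le> D \<longrightarrow> (\<exists>n\<ge>N. heavy m c D T (r n))"
    unfolding AE_all_countable by (intro allI AE_impI) blast
  then have "AE r in UNIF m c T. r \<in> heavy_rays m c T"
    using AE_space
  proof eventually_elim
    case (elim r)
    then show ?case unfolding heavy_rays_def space_UNIF[OF T c m] by blast
  qed
  then show ?thesis
    using emeasure_eq_1_AE[of "heavy_rays m c T"] sets_heavy_rays by (simp add: sets_UNIF[OF T c m])
qed

section \<open>The set of heavy rays has dimension zero\<close>

text \<open>Covers in the Hausdorff content are indexed by naturals, the cover by cylinders is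
  indexed by vertices; an enumeration mediates.\<close>

lemma nn_integral_vertices:
  fixes g :: "vertex \<Rightarrow> ennreal"
  shows "(\<Sum>i. g (from_nat_into UNIV i)) = (\<integral>\<^sup>+ u. g u \<partial>count_space UNIV)"
proof -
  have "bij_betw (from_nat_into UNIV) UNIV (UNIV :: vertex set)"
    by (rule bij_betw_from_nat_into) (auto simp: infinite_UNIV_listI)
  from nn_integral_bij_count_space[OF this, of g] show ?thesis
    by (simp add: nn_integral_count_space_nat)
qed

lemma ediam_cylinder:
  "ediam ray_dist (cylinder T u) \<le> ennreal (exp (- real (length u)))"
  unfolding ediam_def by (intro SUP_least ennreal_leI ray_dist_cylinder)

lemma hausdorff_gauge_cylinder:
  assumes "0 < s"
  shows "hausdorff_gauge ray_dist s (cylinder T u) \<le> ennreal (exp (- s * real (length u)))"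
proof -
  have "enn2real (ediam ray_dist (cylinder T u)) \<le> exp (- real (length u))"
    using ediam_cylinder by (intro enn2real_leI) auto
  then have "enn2real (ediam ray_dist (cylinder T u)) powr s \<le> exp (- real (length u)) powr s"
    using assms by (intro powr_mono2) auto
  also have "\<dots> = exp (- s * real (length u))" by (simp add: powr_def)
  finally show ?thesis using assms by (auto simp: hausdorff_gauge_def intro: ennreal_leI)
qed

lemma sum_emeasure_cylinders_le:
  assumes \<mu>: "sets \<mu> = sets (boundary_borel T)" "prob_space \<mu>" and T: "rooted_tree T"
  shows "(\<Sum>u\<in>level T n. emeasure \<mu> (cylinder T u)) \<le> 1"
proof -
  interpret prob_space \<mu> by fact
  have "disjoint_family_on (cylinder T) (level T n)"
    by (auto simp: disjoint_family_on_def mem_level cylinder_def)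
  then have "(\<Sum>u\<in>level T n. emeasure \<mu> (cylinder T u)) = emeasure \<mu> (\<Union>u\<in>level T n. cylinder T u)"
    by (intro sum_emeasure finite_desc[OF T]) (auto simp: \<mu>(1))
  also have "\<dots> \<le> 1" by (rule emeasure_le_1)
  finally show ?thesis .
qed

text \<open>Mass replaces counting: the gauge of a heavy cylinder at level \<open>n\<close> is at
  most \<open>W_inf c T [] * x ^ n\<close> times its uniform mass. Masses on one level add up to at
  most 1, so covering by the heavy cylinders from level \<open>N\<close> on costs a geometric
  tail.\<close>

lemma hausdorff_content_heavy_rays:
  assumes T: "regular c T" and c: "(\<lambda>n. c (Suc n) / c n) \<longlonglongrightarrow> m" and m: "1 < m"
    and s: "0 < s" and \<delta>: "0 < \<delta>"
  shows "hausdorff_content (boundary T) ray_dist s \<delta> (heavy_rays m c T) = 0"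
proof -
  have W0: "0 < W_inf c T []" using regular_limit(2)[OF T regular_root[OF T]] .
  have rt: "rooted_tree T" using T by (rule regular_rooted)
  \<comment> \<open>Exceeding \<open>ln m / s\<close> is what makes
    \<open>x = m powr (1 / D) * exp (- s)\<close> less than 1.\<close>
  obtain D0 :: nat where D0: "ln m / s < real D0" using reals_Archimedean2 by blast
  define D where "D = D0 + 2"
  have D: "2 \<le> D" "ln m / s < real D" using D0 by (simp_all add: D_def)
  define x where "x = m powr (1 / real D) * exp (- s)"
  have x0: "0 < x" using m by (simp add: x_def)
  have "ln m < s * real D" using D s by (simp add: field_simps)
  then have "ln m / real D < s" using D(1) by (simp add: field_simps)
  then have x1: "x < 1" using m by (simp add: x_def powr_def exp_add[symmetric] del: exp_add)
  have heavy_bound: "ennreal (exp (- s * real (length u))) \<le> ennreal (W_inf c T [] * x ^ length u) * emeasure (UNIF m c T) (cylinder T u)"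
    if u: "u \<in> T" "heavy m c D T u" for u
  proof -
    let ?n = "length u"
    have Wu: "0 < W_inf c T u" using regular_limit(2)[OF T u(1)] .
    have "(m ^ ((D - 1) * ?n)) powr (1 / real D) \<le> (W_inf c T u ^ D) powr (1 / real D)"
      using u(2) m unfolding heavy_def by (intro powr_mono2) auto
    moreover have "(W_inf c T u ^ D) powr (1 / real D) = W_inf c T u"
      using Wu D(1) by (simp add: powr_powr flip: powr_realpow)
    moreover have "(m ^ ((D - 1) * ?n)) powr (1 / real D) = m powr (real ((D - 1) * ?n) / real D)"
      using m by (simp add: powr_powr flip: powr_realpow)
    moreover have "real ((D - 1) * ?n) / real D = real ?n - real ?n / real D"
      using D(1) by (simp add: field_simps of_nat_diff)
    ultimately have "m powr (real ?n - real ?n / real D) \<le> W_inf c T u" by simp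
    then have "m powr (real ?n / real D) * m powr (real ?n - real ?n / real D) \<le> m powr (real ?n / real D) * W_inf c T u"
      by (rule mult_left_mono) simp
    then have mn: "m ^ ?n \<le> m powr (real ?n / real D) * W_inf c T u"
      using m by (simp add: powr_add[symmetric] powr_realpow)
    have xn: "x ^ ?n = m powr (real ?n / real D) * exp (- s * real ?n)"
      using m by (simp add: x_def power_mult_distrib powr_power exp_of_nat_mult[symmetric] mult.commute)
    have "exp (- s * real ?n) * m ^ ?n \<le> exp (- s * real ?n) * (m powr (real ?n / real D) * W_inf c T u)"
      using mn by (rule mult_left_mono) simp
    then have "exp (- s * real ?n) \<le> x ^ ?n * W_inf c T u / m ^ ?n"
      unfolding xn using m by (simp add: pos_le_divide_eq mult_ac)
    also have "\<dots> = W_inf c T [] * x ^ ?n * (W_inf c T u / (m ^ ?n * W_inf c T []))"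
      using W0 by (simp add: field_simps)
    finally have "ennreal (exp (- s * real ?n)) \<le> ennreal (W_inf c T [] * x ^ ?n * (W_inf c T u / (m ^ ?n * W_inf c T [])))"
      by (rule ennreal_leI)
    also have "\<dots> = ennreal (W_inf c T [] * x ^ ?n) * emeasure (UNIF m c T) (cylinder T u)"
      unfolding emeasure_UNIF[OF T c m u(1)] using W0 x0 by (intro ennreal_mult') simp
    finally show ?thesis .
  qed
  have bound: "hausdorff_content (boundary T) ray_dist s \<delta> (heavy_rays m c T) \<le> ennreal (W_inf c T [] * x ^ N / (1 - x))"
    if N: "exp (- real N) \<le> \<delta>" for N
  proof -
    define F where "F = {u \<in> T. N \<le> length u \<and> heavy m c D T u}"
    define U where "U i = (if from_nat_into UNIV i \<in> F then cylinder T (from_nat_into UNIV i) else {})" for i :: nat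
    \<comment> \<open>\<open>g n\<close> lives on level \<open>n + N\<close>, so that the sum over
      vertices can be rearranged by levels.\<close>
    define g where "g n u = (if u \<in> level T (n + N) then ennreal (W_inf c T [] * x ^ (n + N)) * emeasure (UNIF m c T) (cylinder T u) else 0)" for n u
    have "U i \<subseteq> boundary T \<and> ediam ray_dist (U i) \<le> ennreal \<delta>" for i
    proof (cases "from_nat_into UNIV i \<in> F")
      case True
      let ?u = "from_nat_into UNIV i :: vertex"
      have "ediam ray_dist (cylinder T ?u) \<le> ennreal (exp (- real (length ?u)))" by (rule ediam_cylinder)
      also have "\<dots> \<le> ennreal (exp (- real N))" using True by (intro ennreal_leI) (simp add: F_def)
      also have "\<dots> \<le> ennreal \<delta>" using N by (rule ennreal_leI)
      finally show ?thesis using True by (auto simp: U_def cylinder_def)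
    qed (simp add: U_def ediam_def bot_ennreal)
    moreover have "heavy_rays m c T \<subseteq> (\<Union>i. U i)"
    proof
      fix r assume r: "r \<in> heavy_rays m c T"
      then obtain n where n: "N \<le> n" "heavy m c D T (r n)"
        using D(1) unfolding heavy_rays_def by blast
      have rb: "r \<in> boundary T" using r unfolding heavy_rays_def by blast
      obtain i where i: "from_nat_into UNIV i = r n"
        using from_nat_into_surj[of "UNIV :: vertex set" "r n"] by auto
      have "r n \<in> F" using n rb by (simp add: F_def boundary_length boundary_mem)
      then have "r \<in> U i" using rb by (simp add: U_def i cylinder_def boundary_length)
      then show "r \<in> (\<Union>i. U i)" by blast
    qed
    ultimately have "hausdorff_content (boundary T) ray_dist s \<delta> (heavy_rays m c T) \<le> (\<Sum>i. hausdorff_gauge ray_dist s (U i))"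
      unfolding hausdorff_content_def by (intro Inf_lower) blast
    also have "\<dots> = (\<Sum>i. (\<lambda>u. hausdorff_gauge ray_dist s (if u \<in> F then cylinder T u else {})) (from_nat_into UNIV i))"
      by (simp add: U_def)
    also have "\<dots> = (\<integral>\<^sup>+ u. hausdorff_gauge ray_dist s (if u \<in> F then cylinder T u else {}) \<partial>count_space UNIV)"
      by (rule nn_integral_vertices)
    also have "\<dots> \<le> (\<integral>\<^sup>+ u. (\<Sum>n. g n u) \<partial>count_space UNIV)"
    proof (rule nn_integral_mono)
      fix u :: vertex
      show "hausdorff_gauge ray_dist s (if u \<in> F then cylinder T u else {}) \<le> (\<Sum>n. g n u)"
      proof (cases "u \<in> F")
        case True
        then have u: "u \<in> T" "heavy m c D T u" "N \<le> length u" by (simp_all add: F_def)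
        have "hausdorff_gauge ray_dist s (cylinder T u) \<le> g (length u - N) u"
          using order_trans[OF hausdorff_gauge_cylinder[OF s] heavy_bound[OF u(1,2)]] u
          by (simp add: g_def mem_level)
        also have "\<dots> = (\<Sum>n\<in>{length u - N}. g n u)" by simp
        also have "\<dots> \<le> (\<Sum>n. g n u)" by (rule sum_le_suminf) auto
        finally show ?thesis using True by simp
      qed (simp add: hausdorff_gauge_def)
    qed
    also have "\<dots> = (\<Sum>n. \<integral>\<^sup>+ u. g n u \<partial>count_space UNIV)"
      by (rule nn_integral_suminf) simp
    also have "\<dots> \<le> (\<Sum>n. ennreal (W_inf c T [] * x ^ (n + N)))"
    proof (intro suminf_le)
      fix n
      have "(\<integral>\<^sup>+ u. g n u \<partial>count_space UNIV) = (\<Sum>u\<in>level T (n + N). g n u)"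
        by (rule nn_integral_count_space'[OF finite_desc[OF rt]]) (auto simp: g_def)
      also have "\<dots> = ennreal (W_inf c T [] * x ^ (n + N)) * (\<Sum>u\<in>level T (n + N). emeasure (UNIF m c T) (cylinder T u))"
        by (simp add: g_def sum_distrib_left)
      also have "\<dots> \<le> ennreal (W_inf c T [] * x ^ (n + N)) * 1"
        by (intro mult_left_mono sum_emeasure_cylinders_le rt sets_UNIF[OF T c m] prob_space_UNIF[OF T c m]) simp
      finally show "(\<integral>\<^sup>+ u. g n u \<partial>count_space UNIV) \<le> ennreal (W_inf c T [] * x ^ (n + N))" by simp
    qed auto
    also have "\<dots> = ennreal (W_inf c T [] * x ^ N / (1 - x))"
    proof (rule suminf_ennreal_eq)
      have "(\<lambda>n. W_inf c T [] * x ^ N * x ^ n) sums (W_inf c T [] * x ^ N * (1 / (1 - x)))"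
        using x0 x1 by (intro sums_mult geometric_sums) simp
      then show "(\<lambda>n. W_inf c T [] * x ^ (n + N)) sums (W_inf c T [] * x ^ N / (1 - x))"
        by (simp add: power_add mult_ac)
    qed (use W0 x0 in simp)
    finally show ?thesis .
  qed
  have lim: "(\<lambda>N. ennreal (W_inf c T [] * x ^ N / (1 - x))) \<longlonglongrightarrow> ennreal 0"
  proof (rule tendsto_ennrealI)
    have "(\<lambda>N. x ^ N) \<longlonglongrightarrow> 0" using x0 x1 by (intro LIMSEQ_realpow_zero) auto
    then have "(\<lambda>N. W_inf c T [] * x ^ N / (1 - x)) \<longlonglongrightarrow> W_inf c T [] * 0 / (1 - x)"
      using x1 by (intro tendsto_mult tendsto_divide tendsto_const) auto
    then show "(\<lambda>N. W_inf c T [] * x ^ N / (1 - x)) \<longlonglongrightarrow> 0" by simp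
  qed
  obtain N0 :: nat where N0: "- ln \<delta> < real N0" using reals_Archimedean2 by blast
  have "exp (- real N) \<le> \<delta>" if "N0 \<le> N" for N
  proof -
    have "exp (- real N) \<le> exp (ln \<delta>)" using N0 that by simp
    then show ?thesis using \<delta> by simp
  qed
  then have "hausdorff_content (boundary T) ray_dist s \<delta> (heavy_rays m c T) \<le> ennreal 0"
    using bound by (intro LIMSEQ_le_const[OF lim]) blast
  then show ?thesis by simp
qed

lemma hausdorff_dim_heavy_rays:
  assumes T: "regular c T" and c: "(\<lambda>n. c (Suc n) / c n) \<longlonglongrightarrow> m" and m: "1 < m"
  shows "hausdorff_dim (boundary T) ray_dist (heavy_rays m c T) = 0"
proof -
  have "hausdorff_dim (boundary T) ray_dist (heavy_rays m c T) \<le> ennreal s" if "0 < s" for s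
  proof -
    have "hausdorff_measure (boundary T) ray_dist s (heavy_rays m c T) = (SUP \<delta>\<in>{0 :: real<..}. 0)"
      unfolding hausdorff_measure_def
      by (intro SUP_cong refl) (simp add: hausdorff_content_heavy_rays[OF T c m that])
    also have "\<dots> = 0" by (simp add: bot_ennreal)
    finally show ?thesis
      unfolding hausdorff_dim_def using that by (intro Inf_lower) (auto simp: less_imp_le)
  qed
  from this[of "1 / real (Suc n)" for n]
  have "hausdorff_dim (boundary T) ray_dist (heavy_rays m c T) \<le> ennreal (1 / real (Suc n))" for n by simp
  moreover have "(\<lambda>n. ennreal (1 / real (Suc n))) \<longlonglongrightarrow> ennreal 0"
    using lim_inverse_n' by (intro tendsto_ennrealI LIMSEQ_Suc) 
  ultimately have "hausdorff_dim (boundary T) ray_dist (heavy_rays m c T) \<le> ennreal 0"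
    by (intro LIMSEQ_le_const) auto
  then show ?thesis by simp
qed

theorem theorem1p1:
  fixes q :: "nat pmf" and m :: real and c :: "nat \<Rightarrow> real"
  assumes q0: "pmf q 0 = 0"
    and m_def: "m = measure_pmf.expectation q real"
    and m_finite: "integrable (measure_pmf q) real"
    and m_gt_1: "1 < m"
    and seneta_heyde: "AE T in GW q. \<exists>L>0. (\<lambda>n. real (gen_size T n []) / c n) \<longlonglongrightarrow> L"
    and c_ratio: "(\<lambda>n. c (Suc n) / c n) \<longlonglongrightarrow> m"
    and nu_ln_nu: "(\<integral>\<^sup>+ k. ennreal (real k * ln (real k)) \<partial>measure_pmf q) = \<infinity>"
  shows "AE T in GW q. measure_dim ray_dist (UNIF m c T) = 0"
proof -
  interpret seneta_heyde q m c
    by unfold_locales (fact m_def m_finite m_gt_1 seneta_heyde c_ratio nu_ln_nu)+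
  \<comment> \<open>The condition on \<open>D\<close> stays inside as an implication, so that
    \<open>AE_all_countable\<close> can combine all pairs \<open>D\<close>,
    \<open>N\<close>.\<close>
  have "AE T in GW q. 2 \<le> D \<longrightarrow> (\<exists>s :: nat \<Rightarrow> nat. N \<le> s 0 \<and> (\<forall>j. s j < s (Suc j)) \<and>
      (\<forall>v\<in>T. (INF k. kept m c (\<lambda>i. 4 * D * (s (Suc i) - s i)) (\<lambda>i. ennreal (m ^ (4 * (D - 1) * s i))) 0 k (subtree T v)) = 0))"
    for D N
  proof (cases "2 \<le> D")
    case True
    obtain s :: "nat \<Rightarrow> nat" where s: "N \<le> s 0" "\<And>j. s j < s (Suc j)"
      "AE T in GW q. (INF k. kept m c (\<lambda>i. 4 * D * (s (Suc i) - s i)) (\<lambda>i. ennreal (m ^ (4 * (D - 1) * s i))) 0 k T) = 0"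
      using AE_kept_vanishes[OF True, of N] by blast
    from AE_subtree[OF s(3)] show ?thesis
    proof eventually_elim
      case (elim T)
      then show ?case using s(1,2) by (intro impI exI[of _ s] conjI allI)
    qed
  qed simp
  then have "AE T in GW q. \<forall>D N. 2 \<le> D \<longrightarrow> (\<exists>s :: nat \<Rightarrow> nat. N \<le> s 0 \<and> (\<forall>j. s j < s (Suc j)) \<and>
      (\<forall>v\<in>T. (INF k. kept m c (\<lambda>i. 4 * D * (s (Suc i) - s i)) (\<lambda>i. ennreal (m ^ (4 * (D - 1) * s i))) 0 k (subtree T v)) = 0))"
    unfolding AE_all_countable by (intro allI)
  with AE_regular[OF seneta_heyde] show ?thesis
  proof eventually_elim
    case (elim T)
    note T = elim(1)
    have "emeasure (UNIF m c T) (heavy_rays m c T) = 1"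
      by (rule emeasure_heavy_rays[OF T c_ratio m_gt_1]) (use elim(2) in blast)
    moreover have "hausdorff_dim (space (UNIF m c T)) ray_dist (heavy_rays m c T) = 0"
      unfolding space_UNIF[OF T c_ratio m_gt_1] by (rule hausdorff_dim_heavy_rays[OF T c_ratio m_gt_1])
    moreover have "heavy_rays m c T \<in> sets (UNIF m c T)"
      by (simp add: sets_UNIF[OF T c_ratio m_gt_1] sets_heavy_rays)
    ultimately show ?case
      unfolding measure_dim_def by (intro Least_equality) (metis, simp)
  qed
qed

end
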